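(* Let $k\in\mathbb{N}$, $\tau\in\mathbb{H}$, $q=e^{2\pi i\tau}$, $\zeta_j=e^{2\pi i z_j}$, and $$\mathbb{T}_k(\bm z;\tau):=\frac{\vartheta(z_1; (k+1) \tau)\,\vartheta(z_2; (k+1) \tau)\,\vartheta(z_1+z_2; (k+1) \tau)}{\vartheta\left(z_1; \tau\right)\vartheta\left(z_2; \frac{k+1}{2} \tau\right)\vartheta \left(z_1+z_2; \frac{k+1}{2} \tau\right)}.$$ For $ |q| < |\zeta_1|, |\zeta_2|, |\zeta_1 \zeta_2|<1$ and $\bm r=(r_1,r_2) \in \mathbb{Z}^2$, the $\bm r$-th Fourier coefficient (the coefficient of $\zeta_1^{r_1}\zeta_2^{r_2}$) of $\frac{\eta(\tau)^3 \eta(\frac{k+1}{2} \tau )^2}{\eta((k+1)\tau)}\, \mathbb T_k(\bm z;\tau)$ equals $$q^{\frac{k+1}{4} (2r_2+1)}\sum_{\bm n \in \mathbb{Z}^2} (-1)^{n_1} \varrho_{n_1,n_2+r_1}\,\varrho_{n_2+r_2,n_2}\, q^{\frac{n_1(n_1+1)}{2}+n_1 (n_2+r_1)+(k+1)n_2^2+(k+1)(r_2+1)n_2},$$ where $\varrho_{m,n}:=\frac12\left( \mathrm{sgn} ( m+ \frac12 )+\mathrm{sgn} ( n+ \frac12 ) \right)$. In particular, $$\mathbb F_k(\tau)=\frac{\eta(\tau)^3 \eta\left(\frac{k+1}{2} \tau\right)^2}{\eta((k+1)\tau)}\, \mathrm{CT}_{[\bm\zeta]}(\mathbb T_k(\bm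 z;\tau)),$$ where $$\mathbb F_k(\tau):=\frac12 \sum_{\bm n\in\mathbb{Z}^2+\left(0,\frac 12\right)} (-1)^{n_1}\,\mathrm{sgn}(n_1)\,\mathrm{sgn}\left(n_2\right)q^{\frac{n_1^2}{2}+n_1n_2+(k+1)n_2^2}.$$
   Context: $\mathbb{H}$ is the upper half-plane. $\mathrm{sgn}(x)=x/|x|$ for $x\neq0$, $\mathrm{sgn}(0)=0$. $\eta(\tau)=q^{1/24}\prod_{n\ge1}(1-q^n)$ and $\vartheta(z;\tau)=\sum_{n\in\mathbb{Z}+\frac12}e^{\pi i n}q^{\frac{n^2}{2}}e^{2\pi i nz}$. $\mathrm{CT}_{[\bm\zeta]}$ is the constant term of the Laurent expansion in $\zeta_1,\zeta_2$ in the given range. (Up to Euler factors and change of variables, $\mathbb{T}_k$ is the Schur index of the Argyres--Douglas theory of type $(A_1,D_{2k+2})$.) *)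

theory Defs
  imports "HOL-Analysis.Analysis"
begin

text \<open>
  Real powers of \<open>q = exp (2 * pi * \<i> * \<tau>)\<close> are taken with respect to the branch fixed by \<open>\<tau>\<close>.
\<close>

definition qpow :: "complex \<Rightarrow> real \<Rightarrow> complex" where
  "qpow \<tau> x = exp (2 * of_real pi * \<i> * of_real x * \<tau>)"

definition half_ints :: "real set" where
  "half_ints = range (\<lambda>m::int. of_int m + 1 / 2)"

definition dedekind_eta :: "complex \<Rightarrow> complex" where
  "dedekind_eta \<tau> = qpow \<tau> (1 / 24) * (\<Prod>n. 1 - qpow \<tau> 1 ^ Suc n)"

definition jacobi_theta :: "complex \<Rightarrow> complex \<Rightarrow> complex" where
  "jacobi_theta z \<tau> =
     (\<Sum>\<^sub>\<infinity>n\<in>half_ints. exp (of_real pi * \<i> * of_real n) * qpow \<tau> (n\<^sup>2 / 2)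
        * exp (2 * of_real pi * \<i> * of_real n * z))"

definition schur_T :: "nat \<Rightarrow> complex \<Rightarrow> complex \<Rightarrow> complex \<Rightarrow> complex" where
  "schur_T k \<tau> z1 z2 =
     (jacobi_theta z1 (of_nat (k + 1) * \<tau>) * jacobi_theta z2 (of_nat (k + 1) * \<tau>)
        * jacobi_theta (z1 + z2) (of_nat (k + 1) * \<tau>))
     / (jacobi_theta z1 \<tau> * jacobi_theta z2 (of_nat (k + 1) / 2 * \<tau>)
        * jacobi_theta (z1 + z2) (of_nat (k + 1) / 2 * \<tau>))"

definition eta_factor :: "nat \<Rightarrow> complex \<Rightarrow> complex" where
  "eta_factor k \<tau> =
     dedekind_eta \<tau> ^ 3 * (dedekind_eta (of_nat (k + 1) / 2 * \<tau>))\<^sup>2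
       / dedekind_eta (of_nat (k + 1) * \<tau>)"

definition zeta_var :: "complex \<Rightarrow> complex" where
  "zeta_var z = exp (2 * of_real pi * \<i> * z)"

definition zeta_range :: "complex \<Rightarrow> (complex \<times> complex) set" where
  "zeta_range \<tau> =
     {(w1, w2). norm (qpow \<tau> 1) < norm w1 \<and> norm w1 < 1
              \<and> norm (qpow \<tau> 1) < norm w2 \<and> norm w2 < 1
              \<and> norm (qpow \<tau> 1) < norm (w1 * w2) \<and> norm (w1 * w2) < 1}"

text \<open>
  A function \<open>f\<close> of the elliptic variables has the Laurent expansion with coefficients \<open>c\<close> on
  the region \<open>D\<close> of the variables \<open>\<zeta>\<^sub>j = exp (2 * pi * \<i> * z\<^sub>j)\<close> if the double series in integer
  powers of the \<open>\<zeta>\<^sub>j\<close> converges (absolutely) to \<open>f\<close> at every point of the region.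
\<close>

definition laurent_expansion ::
  "(complex \<Rightarrow> complex \<Rightarrow> complex) \<Rightarrow> (complex \<times> complex) set \<Rightarrow> (int \<times> int \<Rightarrow> complex) \<Rightarrow> bool"
where
  "laurent_expansion f D c \<longleftrightarrow>
     (\<forall>z1 z2. (zeta_var z1, zeta_var z2) \<in> D \<longrightarrow>
        ((\<lambda>(r1, r2). c (r1, r2) * zeta_var z1 powi r1 * zeta_var z2 powi r2)
           has_sum f z1 z2) UNIV)"

text \<open>Meaningful only for functions that have exactly one Laurent expansion on \<open>D\<close>.\<close>

definition laurent_coeff ::
  "(complex \<Rightarrow> complex \<Rightarrow> complex) \<Rightarrow> (complex \<times> complex) set \<Rightarrow> int \<times> int \<Rightarrow> complex"
where
  "laurent_coeff f D = (THE c. laurent_expansion f D c)"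

definition constant_term ::
  "(complex \<Rightarrow> complex \<Rightarrow> complex) \<Rightarrow> (complex \<times> complex) set \<Rightarrow> complex"
where
  "constant_term f D = laurent_coeff f D (0, 0)"

definition rho :: "int \<Rightarrow> int \<Rightarrow> real" where
  "rho m n = (sgn (of_int m + 1 / 2) + sgn (of_int n + 1 / 2)) / 2"

definition coeff_term :: "nat \<Rightarrow> complex \<Rightarrow> int \<Rightarrow> int \<Rightarrow> int \<times> int \<Rightarrow> complex" where
  "coeff_term k \<tau> r1 r2 = (\<lambda>(n1, n2).
     (-1) powi n1 * of_real (rho n1 (n2 + r1)) * of_real (rho (n2 + r2) n2)
       * qpow \<tau> (of_int n1 * (of_int n1 + 1) / 2 + of_int n1 * (of_int n2 + of_int r1)
           + real (k + 1) * (of_int n2)\<^sup>2 + real (k + 1) * (of_int r2 + 1) * of_int n2))"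

definition F_term :: "nat \<Rightarrow> complex \<Rightarrow> int \<times> real \<Rightarrow> complex" where
  "F_term k \<tau> = (\<lambda>(n1, n2).
     (-1) powi n1 * of_int (sgn n1) * of_real (sgn n2)
       * qpow \<tau> ((of_int n1)\<^sup>2 / 2 + of_int n1 * n2 + real (k + 1) * n2\<^sup>2))"

definition F_fun :: "nat \<Rightarrow> complex \<Rightarrow> complex" where
  "F_fun k \<tau> = 1 / 2 * (\<Sum>\<^sub>\<infinity>n\<in>UNIV \<times> half_ints. F_term k \<tau> n)"

end

theory Submission
  imports Defs
begin

text \<open>
  By the Jacobi triple product all theta functions become products, and splitting the product for
  the nome \<open>q\<^bsup>(k+1)/2\<^esup>\<close> into even and odd factors turns \<open>\<T>\<^sub>k\<close>, up to the
  eta quotient, into the reciprocal theta function \<open>\<eta>\<^sup>3 / \<theta>\<close> in \<open>\<zeta>\<^sub>1\<close> times Kronecker's quotient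
  \<open>\<eta>\<^sup>3 \<theta>(u v) / (\<theta>(u) \<theta>(v))\<close> with nome \<open>Q = q\<^bsup>k+1\<^esup>\<close>, \<open>u = Q\<^bsup>1/2\<^esup> \<zeta>\<^sub>2\<close> and
  \<open>v = Q\<^bsup>1/2\<^esup> / (\<zeta>\<^sub>1 \<zeta>\<^sub>2)\<close>. Both have classical double series expansions. These are proved by
  multiplying with the theta functions in the denominator and comparing coefficients: along the
  lines \<open>m + n = s\<close> the sums are finite geometric sums, and what remains are theta series at integral
  powers of the nome, which vanish, and Jacobi's series for \<open>\<eta>\<^sup>3\<close>. The product of the two double
  series is the asserted Laurent expansion.
\<close>

text \<open>The even factors of the denominators at zeta_2 and zeta_1 zeta_2 cancel two numerators;
  the odd factors are the theta functions at u and, after the reflection x to Q / x, at v. The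
  numerator left over, at zeta_1, is theta(u v) by the same reflection, because u v = Q / zeta_1.
  Kronecker's series needs |Q| < |u|, |v| < 1, that is, |zeta_2| and |zeta_1 zeta_2| strictly
  between |Q|^(1/2) and |Q|^(-1/2). The given range supplies this because |Q|^(1/2) \<le> |q| for k
  \<ge> 1. The exponent m n of these series is indefinite, but \<open>rho\<close> confines the
  indices to two opposite quadrants, where it is nonnegative. All families are therefore absolutely
  summable and may be regrouped by exponents at will. No zeros or residues are computed: the
  identity for the reciprocal also shows that the theta functions in the denominator do not
  vanish.\<close>

section \<open>Products of summable families and Gaussian majorants\<close>

text \<open>Complex summable families are absolutely summable, so the product family is summable on
  the whole rectangle and not only as an iterated sum. Every product of two expansions below rests
  on this.\<close>

lemma has_sum_times_complex:
  fixes f :: "'a \<Rightarrow> complex" and g :: "'b \<Rightarrow> complex"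
  assumes "(f has_sum x) A" and "(g has_sum y) B"
  shows "((\<lambda>(i, j). f i * g j) has_sum x * y) (A \<times> B)"
proof (rule has_sum_SigmaI)
  show "((\<lambda>j. case (i, j) of (i, j) \<Rightarrow> f i * g j) has_sum f i * y) B" for i
    using has_sum_cmult_right[OF assms(2)] by simp
  show "((\<lambda>i. f i * y) has_sum x * y) A"
    using has_sum_cmult_left[OF assms(1)] by simp
  have "(\<lambda>i. norm (f i)) summable_on A" "(\<lambda>j. norm (g j)) summable_on B"
    using assms summable_on_iff_abs_summable_on_complex has_sum_imp_summable by blast+
  then have "(\<lambda>(i, j). norm (f i) * norm (g j)) summable_on A \<times> B"
    by (intro summable_on_SigmaI[where g = "\<lambda>i. norm (f i) * infsum (\<lambda>j. norm (g j)) B"])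
       (auto intro!: has_sum_cmult_right summable_on_cmult_left)
  then have "(\<lambda>p. norm ((\<lambda>(i, j). f i * g j) p)) summable_on A \<times> B"
    by (simp add: case_prod_unfold norm_mult)
  then show "(\<lambda>(i, j). f i * g j) summable_on A \<times> B"
    by (rule abs_summable_summable)
qed

lemma summable_exp_abs_int:
  fixes c :: real
  assumes "c < 0"
  shows "(\<lambda>j::int. exp (c * of_int \<bar>j\<bar>)) summable_on UNIV"
proof -
  let ?f = "\<lambda>j::int. exp (c * of_int \<bar>j\<bar>)"
  have geo: "(\<lambda>n::nat. exp c ^ n) summable_on UNIV"
    using assms by (intro norm_summable_imp_summable_on) auto
  have "?f summable_on {0..} \<longleftrightarrow> (\<lambda>n::nat. exp c ^ n) summable_on UNIV"
    by (rule summable_on_reindex_bij_witness[of _ int nat])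
       (auto simp: exp_of_nat_mult[symmetric] mult.commute)
  then have "?f summable_on {0..}" using geo by simp
  moreover have "?f summable_on {..<0} \<longleftrightarrow> (\<lambda>n::nat. exp c * exp c ^ n) summable_on UNIV"
    by (rule summable_on_reindex_bij_witness[of _ "\<lambda>n. - int n - 1" "\<lambda>j. nat (- j - 1)"])
       (auto simp: exp_of_nat_mult[symmetric] exp_add[symmetric] algebra_simps)
  then have "?f summable_on {..<0}"
    using summable_on_cmult_right[OF geo] by simp
  ultimately have "?f summable_on {0..} \<union> {..<0}"
    by (intro summable_on_Un_disjoint) auto
  moreover have "{0..} \<union> {..<0} = (UNIV :: int set)" by auto
  ultimately show ?thesis by simp
qed

text \<open>The factor \<open>1 + \<bar>of_int j\<bar>\<close> makes room for the weight
  \<open>j\<close> of a differentiated theta series; it is absorbed by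
  \<open>1 + y \<le> exp y\<close>.\<close>

lemma summable_linear_gauss_int:
  fixes c d :: real
  assumes "c > 0"
  shows "(\<lambda>j::int. (1 + \<bar>of_int j\<bar>) * exp (d * of_int j - c * (of_int j)\<^sup>2)) summable_on UNIV"
proof (rule summable_on_comparison_test)
  \<comment> \<open>This is the maximum of \<open>(\<bar>d\<bar> + 2) * y - c * y^2\<close> over
    real \<open>y\<close>. Of the extra \<open>2 * y\<close>, one half pays for the linear factor
    and the other leaves the majorant \<open>exp (- y)\<close>.\<close>
  define C where "C = (\<bar>d\<bar> + 2)\<^sup>2 / (4 * c)"
  show "(\<lambda>j::int. exp C * exp (-1 * of_int \<bar>j\<bar>)) summable_on UNIV"
    by (intro summable_on_cmult_right summable_exp_abs_int) simp
  fix j :: int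
  define y where "y = \<bar>real_of_int j\<bar>"
  have "d * of_int j \<le> \<bar>d\<bar> * y"
    unfolding y_def abs_mult[symmetric] by simp
  moreover have "(\<bar>d\<bar> + 2) * y - c * y\<^sup>2 \<le> C"
  proof -
    have "0 \<le> (\<bar>d\<bar> + 2 - 2 * c * y)\<^sup>2" by simp
    then show ?thesis
      using assms unfolding C_def by (simp add: field_simps power2_eq_square)
  qed
  moreover have "y\<^sup>2 = (of_int j)\<^sup>2" by (simp add: y_def)
  ultimately have le: "y + (d * of_int j - c * (of_int j)\<^sup>2) \<le> C + - y"
    by (simp add: algebra_simps)
  have "(1 + y) * exp (d * of_int j - c * (of_int j)\<^sup>2)
      \<le> exp y * exp (d * of_int j - c * (of_int j)\<^sup>2)"
    by (intro mult_right_mono exp_ge_add_one_self) auto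
  also have "\<dots> \<le> exp (C + - y)"
    using le by (simp add: exp_add[symmetric])
  finally show "(1 + \<bar>of_int j\<bar>) * exp (d * of_int j - c * (of_int j)\<^sup>2) \<le> exp C * exp (-1 * of_int \<bar>j\<bar>)"
    by (simp add: y_def exp_add[symmetric])
qed auto

section \<open>The Jacobi triple product\<close>

text \<open>Dominated convergence for the counting measure. The majorant \<open>h\<close> makes
  every family involved absolutely summable, so that the integral agrees with
  \<open>infsum\<close>.\<close>

lemma infsum_tendsto_dominated:
  fixes f :: "nat \<Rightarrow> 'a \<Rightarrow> complex"
  assumes lim: "\<And>j. (\<lambda>n. f n j) \<longlonglongrightarrow> g j"
    and bound: "\<And>n j. norm (f n j) \<le> h j"
    and h: "h summable_on UNIV"
  shows "(\<lambda>n. infsum (f n) UNIV) \<longlonglongrightarrow> infsum g UNIV"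
proof -
  let ?M = "count_space (UNIV :: 'a set)"
  have nonneg: "0 \<le> h j" for j
    using bound[of 0 j] norm_ge_zero order_trans by blast
  have h': "Infinite_Set_Sum.abs_summable_on h UNIV"
    unfolding abs_summable_equivalent[symmetric] using h nonneg by simp
  have int: "integrable ?M h"
    using h' by (simp add: Infinite_Set_Sum.abs_summable_on_def)
  have gb: "norm (g j) \<le> h j" for j
    using LIMSEQ_le_const2[OF tendsto_norm[OF lim[of j]]] bound by blast
  have "(\<lambda>n. integral\<^sup>L ?M (f n)) \<longlonglongrightarrow> integral\<^sup>L ?M g"
    by (rule integral_dominated_convergence[OF _ _ int]) (use lim bound in auto)
  moreover have "integral\<^sup>L ?M u = infsum u UNIV" if "\<And>j. norm (u j) \<le> h j" for u :: "'a \<Rightarrow> complex"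
  proof -
    have "(\<lambda>j. norm (u j)) summable_on UNIV"
      using Infinite_Sum.abs_summable_on_comparison_test'[OF h, of u] that by blast
    then show ?thesis
      using infsetsum_infsum[of u UNIV] by (simp add: infsetsum_def flip: abs_summable_equivalent)
  qed
  ultimately show ?thesis
    using bound gb by simp
qed

section \<open>Gaussian binomial coefficients and the finite triple product\<close>

definition qfac :: "complex \<Rightarrow> nat \<Rightarrow> complex" where
  "qfac q n = (\<Prod>i<n. 1 - q ^ Suc i)"

definition euler_phi :: "complex \<Rightarrow> complex" where
  "euler_phi q = (\<Prod>n. 1 - q ^ Suc n)"

text \<open>The default value 0 keeps the q-Pascal rule valid for all \<open>k\<close> and later
  cuts off the sums over all integers from above.\<close>

definition qbinom :: "complex \<Rightarrow> nat \<Rightarrow> nat \<Rightarrow> complex" where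
  "qbinom q n k = (if k \<le> n then qfac q n / (qfac q k * qfac q (n - k)) else 0)"

lemma one_minus_power_nz:
  fixes q :: complex
  assumes "norm q < 1"
  shows "1 - q ^ Suc i \<noteq> 0"
proof
  assume "1 - q ^ Suc i = 0"
  then have "norm q ^ Suc i = 1"
    by (metis eq_iff_diff_eq_0 norm_one norm_power)
  moreover have "norm q ^ Suc i < 1"
    using assms power_decreasing[of 1 "Suc i" "norm q"] by simp
  ultimately show False by simp
qed

lemma qfac_nz: "norm q < 1 \<Longrightarrow> qfac q n \<noteq> 0"
  unfolding qfac_def using one_minus_power_nz by simp

lemma convergent_prod_euler:
  fixes q :: complex
  assumes "norm q < 1"
  shows "convergent_prod (\<lambda>n. 1 - q ^ Suc n)"
proof (rule abs_convergent_prod_imp_convergent_prod, rule summable_imp_abs_convergent_prod)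
  show "summable (\<lambda>n. norm (1 - q ^ Suc n - 1))"
    using assms by (simp add: norm_mult norm_power summable_mult summable_geometric)
qed

lemma euler_phi_nz: "norm q < 1 \<Longrightarrow> euler_phi q \<noteq> 0"
  unfolding euler_phi_def
  by (intro prodinf_nonzero convergent_prod_euler one_minus_power_nz)

lemma qfac_tendsto: 
  assumes "norm q < 1"
  shows "qfac q \<longlonglongrightarrow> euler_phi q"
proof -
  have "(\<lambda>n. qfac q (Suc n)) \<longlonglongrightarrow> euler_phi q"
    using convergent_prod_LIMSEQ[OF convergent_prod_euler[OF assms]]
    by (simp add: euler_phi_def qfac_def lessThan_Suc_atMost)
  then show ?thesis by (rule LIMSEQ_imp_Suc)
qed

text \<open>For \<open>k < n\<close> this is \<open>1 - x * y = (1 - x) + x * (1 - y)\<close>, with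
  \<open>x\<close> and \<open>y\<close> the powers of \<open>q\<close> that complete the two
  factorials in the denominator.\<close>

lemma qbinom_Suc_Suc:
  assumes "norm q < 1"
  shows "qbinom q (Suc n) (Suc k) = qbinom q n k + q ^ Suc k * qbinom q n (Suc k)"
proof -
  consider "k < n" | "k = n" | "k > n" by linarith
  then show ?thesis
  proof cases
    case 1
    then obtain m where n: "n = Suc (k + m)" 
      by (metis less_natE)
    have F: "qfac q (Suc i) = qfac q i * (1 - q ^ Suc i)" for i
      by (simp add: qfac_def)
    note nz = qfac_nz[OF assms]
    define A B N where "A = qfac q k" and "B = qfac q m" and "N = qfac q n"
    define x y where "x = q ^ Suc k" and "y = q ^ Suc m"
    have xy: "q ^ Suc n = x * y" by (simp add: x_def y_def n power_add)
    have "1 - x \<noteq> 0" "1 - y \<noteq> 0" "A \<noteq> 0" "B \<noteq> 0"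
      using one_minus_power_nz[OF assms] nz unfolding x_def y_def A_def B_def by blast+
    then have "N * (1 - x * y) / (A * (1 - x) * (B * (1 - y)))
        = N / (A * (B * (1 - y))) + x * (N / (A * (1 - x) * B))"
      by (simp add: divide_simps) algebra
    moreover have "qbinom q (Suc n) (Suc k) = N * (1 - x * y) / (A * (1 - x) * (B * (1 - y)))"
    proof -
      have "Suc n - Suc k = Suc m" using n by simp
      then show ?thesis
        using 1 by (simp only: qbinom_def F xy A_def[symmetric] B_def[symmetric] N_def[symmetric]
            x_def[symmetric] y_def[symmetric]) simp
    qed
    moreover have "qbinom q n k = N / (A * (B * (1 - y)))"
    proof -
      have "n - k = Suc m" using n by simp
      then show ?thesis
        using 1 by (simp only: qbinom_def F A_def[symmetric] B_def[symmetric] N_def[symmetric]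
            y_def[symmetric]) simp
    qed
    moreover have "qbinom q n (Suc k) = N / (A * (1 - x) * B)"
    proof -
      have "n - Suc k = m" using n by simp
      then show ?thesis
        using 1 by (simp only: qbinom_def F A_def[symmetric] B_def[symmetric] N_def[symmetric]
            x_def[symmetric]) simp
    qed
    ultimately show ?thesis by (simp only: x_def[symmetric])
  next
    case 2
    then show ?thesis using qfac_nz[OF assms] by (simp add: qbinom_def qfac_def[of _ 0])
  next
    case 3
    then show ?thesis by (simp add: qbinom_def)
  qed
qed

lemma qbinom_0: "norm q < 1 \<Longrightarrow> qbinom q n 0 = 1"
  using qfac_nz[of q n] by (simp add: qbinom_def qfac_def[of _ 0])

text \<open>Splitting off the factor with \<open>i = 0\<close> turns the remaining product into the
  one for \<open>y * q\<close>, hence the induction with arbitrary \<open>y\<close>; the q-Pascal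
  rule then matches the coefficients.\<close>

lemma q_binomial_theorem:
  assumes "norm q < 1"
  shows "(\<Prod>i<n. 1 - y * q ^ i) = (\<Sum>k\<le>n. qbinom q n k * (-1) ^ k * q ^ (k choose 2) * y ^ k)"
proof (induction n arbitrary: y)
  case 0
  then show ?case by (simp add: qbinom_0[OF assms] numeral_2_eq_2)
next
  case (Suc n)
  define a where "a k = qbinom q n k * (-1) ^ k * q ^ (k choose 2) * (y * q) ^ k" for k
  have a0: "a 0 = 1" by (simp add: a_def qbinom_0[OF assms] numeral_2_eq_2)
  have aS: "a (Suc n) = 0" by (simp add: a_def qbinom_def)
  have step: "a (Suc k) - y * a k
      = qbinom q (Suc n) (Suc k) * (-1) ^ Suc k * q ^ (Suc k choose 2) * y ^ Suc k" for k
    unfolding a_def qbinom_Suc_Suc[OF assms]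
    by (simp add: numeral_2_eq_2 power_add power_mult_distrib algebra_simps)
  have "(\<Prod>i<Suc n. 1 - y * q ^ i) = (1 - y) * (\<Prod>i<n. 1 - (y * q) * q ^ i)"
    by (subst prod.lessThan_Suc_shift) (simp add: mult.assoc)
  also have "\<dots> = (1 - y) * (\<Sum>k\<le>n. a k)"
    by (simp only: Suc.IH a_def)
  also have "\<dots> = (\<Sum>k\<le>Suc n. a k) - (\<Sum>k\<le>n. y * a k)"
    by (simp add: aS left_diff_distrib sum_distrib_left[symmetric])
  also have "(\<Sum>k\<le>Suc n. a k) = 1 + (\<Sum>k\<le>n. a (Suc k))"
    by (simp only: sum.atMost_Suc_shift a0)
  also have "1 + (\<Sum>k\<le>n. a (Suc k)) - (\<Sum>k\<le>n. y * a k) = 1 + (\<Sum>k\<le>n. a (Suc k) - y * a k)"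
    by (simp add: sum_subtractf)
  also have "\<dots> = (\<Sum>k\<le>Suc n. qbinom q (Suc n) k * (-1) ^ k * q ^ (k choose 2) * y ^ k)"
    by (subst sum.atMost_Suc_shift) (simp only: step, simp add: qbinom_0[OF assms] numeral_2_eq_2)
  finally show ?case .
qed

text \<open>With \<open>q = exp t\<close> and \<open>x = exp a\<close>, \<open>theta t a\<close> below is the sum of \<open>(-1)\<^sup>j q\<^bsup>j(j-1)/2\<^esup> x\<^sup>j\<close>;
  taking \<open>t\<close> and \<open>a\<close> instead of \<open>q\<close> and \<open>x\<close> as arguments fixes all fractional powers.\<close>

definition theta_coeff :: "complex \<Rightarrow> int \<Rightarrow> complex" where
  "theta_coeff t j = (-1) powi j * exp (t * (of_int j * (of_int j - 1) / 2))"

lemma exp_choose_two: "exp t ^ (k choose 2) = exp (t * (of_nat k * (of_nat k - 1) / 2))" for t :: complex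
proof -
  have "2 * (k choose 2) = k * (k - 1)" by (cases k) (simp_all add: choose_two)
  then have "(2::complex) * of_nat (k choose 2) = of_nat (k * (k - 1))"
    by (metis of_nat_mult of_nat_numeral)
  also have "\<dots> = of_nat k * (of_nat k - 1)" by (cases k) (auto simp: algebra_simps)
  finally have "of_nat (k choose 2) = (of_nat k * (of_nat k - 1) / 2 :: complex)" by (simp add: field_simps)
  then show ?thesis by (simp only: exp_of_nat_mult[symmetric] mult.commute[of t])
qed

text \<open>This is the q-binomial theorem of length \<open>2 * n\<close> at
  \<open>y = x / q ^ n\<close>. The upper \<open>n\<close> factors are \<open>1 - x * q ^ i\<close>;
  the lower ones, in reversed order, become \<open>1 - q ^ Suc i / x\<close> once
  \<open>- x / q ^ Suc i\<close> is pulled out. The power \<open>x ^ n\<close> turns both sides into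
  polynomials in \<open>x\<close>.\<close>

lemma finite_triple_product:
  assumes "Re t < 0" and "x \<noteq> 0"
  shows "x ^ n * (\<Prod>i<n. (1 - x * exp t ^ i) * (1 - exp t ^ Suc i / x))
    = (\<Sum>k\<le>2 * n. qbinom (exp t) (2 * n) k * theta_coeff t (int k - int n) * x ^ k)"
proof -
  define q where "q = exp t"
  have q: "norm q < 1" "q \<noteq> 0" using assms by (auto simp: q_def)
  define y where "y = x / q ^ n"
  \<comment> \<open>The product of the numbers \<open>- (q ^ Suc i)\<close> for
    \<open>i < n\<close>, which are left over from the lower factors.\<close>
  define c where "c = (-1) ^ n * exp (t * (of_nat n * (of_nat n + 1) / 2))"
  have sumn: "(\<Sum>i<n. of_nat (Suc i)) = (of_nat n * (of_nat n + 1) / 2 :: complex)"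
    by (induction n) (simp_all add: field_simps)
  have "(\<Prod>i<n. 1 - y * q ^ i) = (\<Prod>i<n. 1 - y * q ^ (n - Suc i))"
    by (rule prod.nat_diff_reindex[symmetric])
  also have "\<dots> = (\<Prod>i<n. (- x / q ^ Suc i) * (1 - q ^ Suc i / x))"
  proof (rule prod.cong)
    fix i assume "i \<in> {..<n}"
    then have "q ^ n = q ^ (n - Suc i) * q ^ Suc i" by (simp only: power_add[symmetric]) simp
    then have "y * q ^ (n - Suc i) = x / q ^ Suc i"
      using q by (simp add: y_def)
    then show "1 - y * q ^ (n - Suc i) = (- x / q ^ Suc i) * (1 - q ^ Suc i / x)"
      using q assms by (simp add: field_simps)
  qed simp
  also have "\<dots> = (\<Prod>i<n. - x / q ^ Suc i) * (\<Prod>i<n. 1 - q ^ Suc i / x)"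
    by (rule prod.distrib)
  also have "(\<Prod>i<n. - x / q ^ Suc i) = x ^ n / c"
  proof -
    have "(\<Prod>i<n. - x / q ^ Suc i) = (- x) ^ n / (\<Prod>i<n. q ^ Suc i)"
      by (simp only: prod_dividef) simp
    also have "(\<Prod>i<n. q ^ Suc i) = exp (\<Sum>i<n. of_nat (Suc i) * t)"
      unfolding exp_sum[OF finite_lessThan] exp_of_nat_mult q_def by (rule refl)
    also have "(\<Sum>i<n. of_nat (Suc i) * t) = t * (of_nat n * (of_nat n + 1) / 2)"
      by (simp only: sum_distrib_right[symmetric] sumn) (rule mult.commute)
    finally have "(\<Prod>i<n. - x / q ^ Suc i) = ((-1) ^ n * x ^ n) / exp (t * (of_nat n * (of_nat n + 1) / 2))"
      by (simp only: power_minus[of x])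
    also have "\<dots> = x ^ n / c" by (simp add: c_def uminus_power_if)
    finally show ?thesis .
  qed
  finally have lower: "(\<Prod>i<n. 1 - y * q ^ i) = x ^ n / c * (\<Prod>i<n. 1 - q ^ Suc i / x)" .
  have "(\<Prod>i<n + m. f i) = (\<Prod>i<n. f i) * (\<Prod>i<m. f (n + i))" for f :: "nat \<Rightarrow> complex" and m
    by (induction m) (simp_all add: mult_ac)
  from this[of "\<lambda>i. 1 - y * q ^ i" n]
  have "(\<Prod>i<2 * n. 1 - y * q ^ i) = (\<Prod>i<n. 1 - y * q ^ i) * (\<Prod>i<n. 1 - y * q ^ (n + i))"
    by (simp only: mult_2)
  also have "(\<Prod>i<n. 1 - y * q ^ (n + i)) = (\<Prod>i<n. 1 - x * q ^ i)"
    using q by (simp add: y_def power_add)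
  finally have split: "c * (\<Prod>i<2 * n. 1 - y * q ^ i)
      = x ^ n * (\<Prod>i<n. (1 - x * q ^ i) * (1 - q ^ Suc i / x))"
    unfolding lower by (simp add: c_def prod.distrib)
  have "c * (qbinom q (2 * n) k * (-1) ^ k * q ^ (k choose 2) * y ^ k)
      = qbinom q (2 * n) k * theta_coeff t (int k - int n) * x ^ k" for k
  proof -
    have sg: "(-1) ^ n * (-1) ^ k = ((-1) powi (int k - int n) :: complex)"
      by (simp add: power_int_minus_left uminus_power_if)
    have "exp (t * (of_nat n * (of_nat n + 1) / 2)) * q ^ (k choose 2) / (q ^ n) ^ k
        = exp (t * (of_nat n * (of_nat n + 1) / 2) + t * (of_nat k * (of_nat k - 1) / 2)
            - of_nat (n * k) * t)"
      unfolding q_def exp_choose_two by (simp only: exp_add exp_diff exp_of_nat_mult power_mult)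
    also have "t * (of_nat n * (of_nat n + 1) / 2) + t * (of_nat k * (of_nat k - 1) / 2)
          - of_nat (n * k) * t
        = t * (of_int (int k - int n) * (of_int (int k - int n) - 1) / 2)"
      by (simp add: field_simps)
    finally have ex: "exp (t * (of_nat n * (of_nat n + 1) / 2)) * q ^ (k choose 2) / (q ^ n) ^ k
        = exp (t * (of_int (int k - int n) * (of_int (int k - int n) - 1) / 2))" .
    show ?thesis
      unfolding theta_coeff_def ex[symmetric] sg[symmetric] c_def y_def
      by (simp add: power_divide)
  qed
  then show ?thesis
    unfolding q_def[symmetric] split[symmetric] q_binomial_theorem[OF q(1), of y "2 * n"]
    by (simp only: sum_distrib_left)
qed

section \<open>Passage to the limit: theta series and Jacobi's series for the cube of the Euler
  product\<close>

definition theta :: "complex \<Rightarrow> complex \<Rightarrow> complex" where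
  "theta t a = (\<Sum>\<^sub>\<infinity>j. theta_coeff t j * exp (of_int j * a))"

lemma norm_theta_coeff: "norm (theta_coeff t j) = exp (Re t * (of_int j * (of_int j - 1) / 2))"
proof -
  define r :: real where "r = of_int j * (of_int j - 1) / 2"
  have "(of_int j * (of_int j - 1) / 2 :: complex) = of_real r" by (simp add: r_def)
  then show ?thesis
    unfolding theta_coeff_def norm_mult r_def[symmetric] norm_exp_eq_Re
    by (simp add: norm_power_int)
qed

lemma summable_theta_coeff_bound:
  fixes d :: real
  assumes "Re t < 0"
  shows "(\<lambda>j. norm (theta_coeff t j) * ((1 + \<bar>of_int j\<bar>) * exp (d * of_int j))) summable_on UNIV"
proof -
  have "norm (theta_coeff t j) * ((1 + \<bar>of_int j\<bar>) * exp (d * of_int j))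
      = (1 + \<bar>of_int j\<bar>) * exp ((d - Re t / 2) * of_int j - (- Re t / 2) * (of_int j)\<^sup>2)" for j
    by (simp add: norm_theta_coeff exp_add[symmetric] field_simps power2_eq_square)
  then show ?thesis
    by (simp only:) (intro summable_linear_gauss_int, use assms in simp)
qed

lemma summable_theta_coeff_weighted:
  assumes "Re t < 0" and "\<And>j. norm (w j) \<le> (1 + \<bar>of_int j\<bar>) * exp (d * of_int j)"
  shows "(\<lambda>j. theta_coeff t j * w j) summable_on UNIV"
proof (rule abs_summable_summable, rule Infinite_Sum.abs_summable_on_comparison_test')
  show "norm (theta_coeff t j * w j) \<le> norm (theta_coeff t j) * ((1 + \<bar>of_int j\<bar>) * exp (d * of_int j))" for j
    using assms(2) by (simp add: norm_mult mult_left_mono)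
qed (rule summable_theta_coeff_bound[OF assms(1)])

lemma norm_exp_of_int_bound:
  "norm (exp (of_int j * a)) \<le> (1 + \<bar>of_int j\<bar>) * exp (Re a * of_int j)"
proof -
  have "Re (of_int j * a) = Re a * of_int j" by simp
  then show ?thesis by (simp add: norm_exp_eq_Re algebra_simps)
qed

lemma theta_has_sum:
  assumes "Re t < 0"
  shows "((\<lambda>j. theta_coeff t j * exp (of_int j * a)) has_sum theta t a) UNIV"
  unfolding theta_def
  by (rule has_sum_infsum, rule summable_theta_coeff_weighted[OF assms norm_exp_of_int_bound])

lemma qbinom_central_tendsto:
  assumes q: "norm q < 1"
  shows "(\<lambda>n. qbinom q (2 * n) (nat (int n + j))) \<longlonglongrightarrow> 1 / euler_phi q"
proof -
  note lim = qfac_tendsto[OF q]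
  have shift: "filterlim (\<lambda>n. nat (int n + i)) at_top sequentially" for i
    unfolding filterlim_at_top
  proof
    show "\<forall>\<^sub>F n in sequentially. Z \<le> nat (int n + i)" for Z
      by (rule eventually_sequentiallyI[of "nat (int Z + \<bar>i\<bar>)"]) linarith
  qed
  have double: "filterlim (\<lambda>n::nat. 2 * n) at_top sequentially"
    by (simp add: filterlim_subseq strict_mono_def)
  have "(\<lambda>n. qfac q (2 * n) / (qfac q (nat (int n + j)) * qfac q (nat (int n + - j))))
      \<longlonglongrightarrow> euler_phi q / (euler_phi q * euler_phi q)"
    by (intro tendsto_divide tendsto_mult filterlim_compose[OF lim] shift double) (simp add: euler_phi_nz q)
  moreover have "\<forall>\<^sub>F n in sequentially. qfac q (2 * n) / (qfac q (nat (int n + j)) * qfac q (nat (int n + - j)))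
      = qbinom q (2 * n) (nat (int n + j))"
  proof (rule eventually_sequentiallyI)
    fix n assume "nat \<bar>j\<bar> \<le> n"
    then have "nat (int n + j) \<le> 2 * n" "2 * n - nat (int n + j) = nat (int n + - j)" by linarith+
    then show "qfac q (2 * n) / (qfac q (nat (int n + j)) * qfac q (nat (int n + - j)))
      = qbinom q (2 * n) (nat (int n + j))"
      by (simp add: qbinom_def)
  qed
  ultimately have "(\<lambda>n. qbinom q (2 * n) (nat (int n + j))) \<longlonglongrightarrow> euler_phi q / (euler_phi q * euler_phi q)"
    by (rule Lim_transform_eventually)
  then show ?thesis
    using euler_phi_nz[OF q] by simp
qed

text \<open>Both \<open>qfac q\<close> and its inverse converge, the latter because the Euler
  product is nonzero, so both are bounded. This provides a majorant that does not depend on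
  \<open>n\<close>.\<close>

lemma qbinom_bounded:
  assumes q: "norm q < 1"
  obtains C where "\<And>n k. norm (qbinom q n k) \<le> C"
proof -
  have "Bseq (qfac q)"
    using qfac_tendsto[OF q] convergent_imp_Bseq convergentI by blast
  then obtain A where A: "\<And>n. norm (qfac q n) \<le> A"
    by (auto simp: Bseq_def)
  have "(\<lambda>n. inverse (qfac q n)) \<longlonglongrightarrow> inverse (euler_phi q)"
    using qfac_tendsto[OF q] euler_phi_nz[OF q] by (rule tendsto_inverse)
  then have "Bseq (\<lambda>n. inverse (qfac q n))"
    using convergent_imp_Bseq convergentI by blast
  then obtain B where B: "\<And>n. norm (inverse (qfac q n)) \<le> B"
    by (auto simp: Bseq_def)
  have "norm (qbinom q n k) \<le> A * (B * B)" for n k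
  proof (cases "k \<le> n")
    case True
    have "norm (qbinom q n k) = norm (qfac q n) * (norm (inverse (qfac q k)) * norm (inverse (qfac q (n - k))))"
      using True by (simp add: qbinom_def norm_divide norm_mult norm_inverse divide_inverse)
    also have "\<dots> \<le> A * (B * B)"
      using A B order_trans[OF norm_ge_zero A] order_trans[OF norm_ge_zero B]
      by (intro mult_mono mult_nonneg_nonneg) auto
    finally show ?thesis .
  next
    case False
    then show ?thesis
      using order_trans[OF norm_ge_zero A] order_trans[OF norm_ge_zero B] by (simp add: qbinom_def)
  qed
  then show ?thesis by (rule that)
qed

text \<open>Tannery's theorem lets one pass to the limit in the finite triple product, and equally in its
  derivative, where the weight is \<open>j\<close> instead of \<open>x\<^sup>j\<close>.\<close>

lemma weighted_finite_theta_tendsto: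
  assumes t: "Re t < 0" and w: "\<And>j. norm (w j) \<le> (1 + \<bar>of_int j\<bar>) * exp (d * of_int j)"
  shows "(\<lambda>n. \<Sum>k\<le>2 * n. qbinom (exp t) (2 * n) k * theta_coeff t (int k - int n) * w (int k - int n))
    \<longlonglongrightarrow> (\<Sum>\<^sub>\<infinity>j. theta_coeff t j * w j) / euler_phi (exp t)"
proof -
  define q where "q = exp t"
  have q: "norm q < 1" using t by (simp add: q_def)
  obtain C where C: "\<And>n k. norm (qbinom q n k) \<le> C" using qbinom_bounded[OF q] by blast
  have C0: "0 \<le> C" using order_trans[OF norm_ge_zero C] .
  \<comment> \<open>The finite sum extended by zero to all integers. Above \<open>n\<close> the
    default of \<open>qbinom\<close> gives 0; below \<open>- int n\<close> the truncation in
    \<open>nat\<close> would give index 0 and the value 1, so this side is cut off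
    explicitly.\<close>
  define f where "f n j = (if - int n \<le> j then qbinom q (2 * n) (nat (int n + j)) else 0)
      * (theta_coeff t j * w j)" for n j
  let ?S = "\<lambda>n. \<Sum>k\<le>2 * n. qbinom q (2 * n) k * theta_coeff t (int k - int n) * w (int k - int n)"
  have "infsum (f n) UNIV = ?S n" for n
  proof -
    have "(f n has_sum (\<Sum>j\<in>{- int n..int n}. f n j)) UNIV"
    proof (rule has_sum_finite_neutralI[of "{- int n..int n}"])
      fix j assume "j \<in> UNIV - {- int n..int n}"
      then show "f n j = 0" by (auto simp: f_def qbinom_def nat_le_iff)
    qed auto
    then have "infsum (f n) UNIV = (\<Sum>j\<in>{- int n..int n}. f n j)" by (rule infsumI)
    also have "\<dots> = ?S n"
      by (rule sum.reindex_bij_witness[of _ "\<lambda>k. int k - int n" "\<lambda>j. nat (int n + j)"])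
         (auto simp: f_def)
    finally show ?thesis .
  qed
  moreover have "(\<lambda>n. infsum (f n) UNIV) \<longlonglongrightarrow> (\<Sum>\<^sub>\<infinity>j. 1 / euler_phi q * (theta_coeff t j * w j))"
  proof (rule infsum_tendsto_dominated)
    fix j
    have "(\<lambda>n. qbinom q (2 * n) (nat (int n + j)) * (theta_coeff t j * w j))
        \<longlonglongrightarrow> 1 / euler_phi q * (theta_coeff t j * w j)"
      by (intro tendsto_mult_right qbinom_central_tendsto q)
    moreover have "\<forall>\<^sub>F n in sequentially. qbinom q (2 * n) (nat (int n + j)) * (theta_coeff t j * w j) = f n j"
      by (rule eventually_sequentiallyI[of "nat \<bar>j\<bar>"]) (auto simp: f_def)
    ultimately show "(\<lambda>n. f n j) \<longlonglongrightarrow> 1 / euler_phi q * (theta_coeff t j * w j)"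
      by (rule Lim_transform_eventually)
  next
    fix n j
    have "norm (f n j) \<le> C * norm (theta_coeff t j * w j)"
      using C C0 by (simp add: f_def norm_mult mult_right_mono)
    also have "\<dots> \<le> C * (norm (theta_coeff t j) * ((1 + \<bar>of_int j\<bar>) * exp (d * of_int j)))"
      using w C0 by (simp add: norm_mult mult_left_mono)
    finally show "norm (f n j) \<le> C * (norm (theta_coeff t j) * ((1 + \<bar>of_int j\<bar>) * exp (d * of_int j)))" .
  next
    show "(\<lambda>j. C * (norm (theta_coeff t j) * ((1 + \<bar>of_int j\<bar>) * exp (d * of_int j)))) summable_on UNIV"
      by (intro summable_on_cmult_right summable_theta_coeff_bound t)
  qed
  ultimately show ?thesis
    by (simp only: infsum_cmult_right' q_def) simp
qed

text \<open>Dividing the finite identity by \<open>exp a ^ n\<close> centres the sum at index 0. The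
  limit of partial products is the form needed for duplication, where products of length
  \<open>2 * n\<close> and \<open>n\<close> are compared.\<close>

lemma triple_product_tendsto:
  assumes "Re t < 0"
  shows "(\<lambda>n. \<Prod>i<n. (1 - exp a * exp t ^ i) * (1 - exp t ^ Suc i / exp a))
    \<longlonglongrightarrow> theta t a / euler_phi (exp t)"
proof -
  have "(\<Prod>i<n. (1 - exp a * exp t ^ i) * (1 - exp t ^ Suc i / exp a))
      = (\<Sum>k\<le>2 * n. qbinom (exp t) (2 * n) k * theta_coeff t (int k - int n)
          * exp (of_int (int k - int n) * a))" (is "?P = _") for n
  proof -
    have e: "exp a ^ k / exp a ^ n = exp (of_int (int k - int n) * a)" for k
      by (simp add: exp_of_nat_mult[symmetric] exp_diff[symmetric] algebra_simps)
    have "?P = (exp a ^ n * ?P) / exp a ^ n" by simp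
    also have "\<dots> = (\<Sum>k\<le>2 * n. qbinom (exp t) (2 * n) k * theta_coeff t (int k - int n)
          * (exp a ^ k / exp a ^ n))"
      by (simp only: finite_triple_product[OF assms exp_not_eq_zero] sum_divide_distrib times_divide_eq_right)
    finally show ?thesis unfolding e .
  qed
  then show ?thesis
    using weighted_finite_theta_tendsto[OF assms norm_exp_of_int_bound, of a] by (simp add: theta_def)
qed

text \<open>The finite triple product contains the factor \<open>1 - x\<close>, so its derivative at
  \<open>x = 1\<close> is minus the product of the other factors. Differentiating before the limit
  involves polynomials only, and no theta series has to be differentiated term by term.\<close>

lemma jacobi_cube_identity:
  assumes t: "Re t < 0"
  shows "((\<lambda>j. theta_coeff t j * of_int j) has_sum (- (euler_phi (exp t) ^ 3))) UNIV"
proof -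
  define q where "q = exp t"
  have q: "norm q < 1" using t by (simp add: q_def)
  note nz = euler_phi_nz[OF q]
  define b where "b n k = qbinom q (2 * n) k * theta_coeff t (int k - int n)" for n k
  have fin: "(\<Sum>k\<le>2 * Suc n. b (Suc n) k * of_int (int k - int (Suc n))) = - (qfac q n * qfac q (Suc n))" for n
  proof -
    define R where "R x = x ^ Suc n * ((\<Prod>i<n. 1 - x * q ^ Suc i) * (\<Prod>i<Suc n. 1 - q ^ Suc i / x))" for x
    have eq: "(\<Sum>k\<le>2 * Suc n. b (Suc n) k * x ^ k) = (1 - x) * R x" if "x \<noteq> 0" for x
    proof -
      have "(\<Sum>k\<le>2 * Suc n. b (Suc n) k * x ^ k)
          = x ^ Suc n * (\<Prod>i<Suc n. (1 - x * q ^ i) * (1 - q ^ Suc i / x))"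
        unfolding b_def q_def by (rule finite_triple_product[OF t that, symmetric])
      also have "(\<Prod>i<Suc n. (1 - x * q ^ i) * (1 - q ^ Suc i / x))
          = (1 - x) * (\<Prod>i<n. 1 - x * q ^ Suc i) * (\<Prod>i<Suc n. 1 - q ^ Suc i / x)"
        by (simp only: prod.distrib prod.lessThan_Suc_shift[of "\<lambda>i. 1 - x * q ^ i"]) simp
      finally show ?thesis by (simp add: R_def mult_ac)
    qed
    have R1: "R 1 = qfac q n * qfac q (Suc n)" by (simp add: R_def qfac_def)
    have zero: "(\<Sum>k\<le>2 * Suc n. b (Suc n) k) = 0" using eq[of 1] by simp
    let ?p = "\<lambda>x. \<Sum>k\<le>2 * Suc n. b (Suc n) k * x ^ k"
    have "(?p has_field_derivative (\<Sum>k\<le>2 * Suc n. b (Suc n) k * of_nat k)) (at 1)"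
      by (rule DERIV_cong, (rule derivative_eq_intros refl)+) (simp add: mult.commute)
    \<comment> \<open>In the form of Caratheodory, continuity of \<open>R\<close> at 1 is enough;
      the product \<open>R\<close> itself is never differentiated.\<close>
    moreover have "((\<lambda>x. (1 - x) * R x) has_field_derivative (- R 1)) (at 1)"
      unfolding DERIV_caratheodory_within
    proof (intro exI[of _ "\<lambda>x. - R x"] conjI allI)
      show "continuous (at 1) (\<lambda>x. - R x)"
        unfolding R_def by (intro continuous_intros) auto
    qed (simp_all add: algebra_simps)
    then have "(?p has_field_derivative (- R 1)) (at 1)"
    proof (rule has_field_derivative_transform_within_open[of _ _ _ "- {0}"])
      show "(1 - x) * R x = ?p x" if "x \<in> - {0}" for x using eq[of x] that by simp
    qed auto
    ultimately have "(\<Sum>k\<le>2 * Suc n. b (Suc n) k * of_nat k) = - R 1"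
      by (rule DERIV_unique)
    \<comment> \<open>The weight \<open>k\<close> may be replaced by \<open>k - Suc n\<close>,
      because the unweighted coefficients sum to 0.\<close>
    then have "(\<Sum>k\<le>2 * Suc n. b (Suc n) k * of_nat k) - of_nat (Suc n) * (\<Sum>k\<le>2 * Suc n. b (Suc n) k) = - R 1"
      unfolding zero by simp
    then show ?thesis
      unfolding R1 sum_distrib_left sum_subtractf[symmetric] by (simp add: algebra_simps)
  qed
  have bnd: "norm (of_int j :: complex) \<le> (1 + \<bar>of_int j\<bar>) * exp (0 * of_int j)" for j
    by simp
  have "(\<lambda>n. \<Sum>k\<le>2 * n. b n k * of_int (int k - int n))
      \<longlonglongrightarrow> (\<Sum>\<^sub>\<infinity>j. theta_coeff t j * of_int j) / euler_phi q"
    unfolding b_def q_def by (rule weighted_finite_theta_tendsto[OF t bnd])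
  then have "(\<lambda>n. \<Sum>k\<le>2 * Suc n. b (Suc n) k * of_int (int k - int (Suc n)))
      \<longlonglongrightarrow> (\<Sum>\<^sub>\<infinity>j. theta_coeff t j * of_int j) / euler_phi q"
    by (rule LIMSEQ_Suc)
  moreover have "(\<lambda>n. - (qfac q n * qfac q (Suc n))) \<longlonglongrightarrow> - (euler_phi q * euler_phi q)"
    by (intro tendsto_intros LIMSEQ_Suc qfac_tendsto q)
  ultimately have "(\<Sum>\<^sub>\<infinity>j. theta_coeff t j * of_int j) / euler_phi q = - (euler_phi q * euler_phi q)"
    unfolding fin using LIMSEQ_unique by blast
  then have "(\<Sum>\<^sub>\<infinity>j. theta_coeff t j * of_int j) = - (euler_phi q ^ 3)"
    using nz by (simp add: field_simps power3_eq_cube)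
  then show ?thesis
    using has_sum_infsum[OF summable_theta_coeff_weighted[OF t bnd]] by (simp add: q_def)
qed

section \<open>Functional equations and zeros of theta\<close>

text \<open>With q = \<open>exp t\<close> and x = \<open>exp a\<close>, the factors
  \<open>1 - x q^i\<close> with even \<open>i\<close> belong to nome q^2 at \<open>a\<close>, those
  with odd \<open>i\<close> to nome q^2 at \<open>a + t\<close>. Among the factors
  \<open>1 - q^i / x\<close> the odd exponents go with \<open>a + t\<close>, since q^(2 i + 1) / x =
  q^(2 (i + 1)) / (x q).\<close>

lemma theta_duplication:
  assumes t: "Re t < 0"
  shows "theta t a * euler_phi (exp (2 * t)) ^ 2 = theta (2 * t) a * theta (2 * t) (a + t) * euler_phi (exp t)"
proof -
  define P where "P t a n = (\<Prod>i<n. (1 - exp a * exp t ^ i) * (1 - exp t ^ Suc i / exp a))" for t a :: complex and n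
  have lim: "P s b \<longlonglongrightarrow> theta s b / euler_phi (exp s)" if "Re s < 0" for s b
    unfolding P_def by (rule triple_product_tendsto[OF that])
  have "P t a (2 * n) = P (2 * t) a n * P (2 * t) (a + t) n" for n
  proof (induction n)
    case (Suc n)
    define u where "u = exp t ^ n * exp t ^ n"
    have u: "exp (2 * t) ^ n = u" "exp t ^ (2 * n) = u"
      by (simp_all only: u_def mult_2 exp_add power_mult_distrib power_add)
    have S: "P s b (Suc m) = P s b m * ((1 - exp b * exp s ^ m) * (1 - exp s * exp s ^ m / exp b))" for s b m
      by (simp add: P_def)
    have e: "exp (2 * t) = exp t * exp t" by (simp add: exp_double power2_eq_square)
    have "P t a (2 * Suc n) = P t a (2 * n) * ((1 - exp a * u) * (1 - exp t * u / exp a))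
        * ((1 - exp a * (exp t * u)) * (1 - exp t * (exp t * u) / exp a))"
      by (simp only: mult_Suc_right add_2_eq_Suc S power_Suc u)
    also have "\<dots> = P (2 * t) a n * ((1 - exp a * u) * (1 - exp (2 * t) * u / exp a))
        * (P (2 * t) (a + t) n * ((1 - exp (a + t) * u) * (1 - exp (2 * t) * u / exp (a + t))))"
      by (simp only: Suc.IH e exp_add) (simp add: mult_ac)
    also have "\<dots> = P (2 * t) a (Suc n) * P (2 * t) (a + t) (Suc n)"
      by (simp only: S u)
    finally show ?case .
  qed (simp add: P_def)
  then have "(\<lambda>n. P t a (2 * n)) \<longlonglongrightarrow> theta (2 * t) a / euler_phi (exp (2 * t)) * (theta (2 * t) (a + t) / euler_phi (exp (2 * t)))"
    by (simp only:) (intro tendsto_mult lim, use t in simp_all)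
  moreover have "(\<lambda>n. P t a (2 * n)) \<longlonglongrightarrow> theta t a / euler_phi (exp t)"
    by (rule filterlim_compose[OF lim[OF t]]) (simp add: filterlim_subseq strict_mono_def)
  ultimately have "theta (2 * t) a / euler_phi (exp (2 * t)) * (theta (2 * t) (a + t) / euler_phi (exp (2 * t)))
      = theta t a / euler_phi (exp t)"
    by (rule LIMSEQ_unique)
  moreover have "euler_phi (exp t) \<noteq> 0" "euler_phi (exp (2 * t)) \<noteq> 0"
    using t by (auto intro!: euler_phi_nz)
  ultimately show ?thesis by (simp add: field_simps power2_eq_square)
qed

lemma theta_coeff_reflect: "theta_coeff t (1 - j) = - theta_coeff t j"
proof -
  have "(-1) powi (1 - j) = - ((-1) powi j :: complex)"
    by (simp add: power_int_minus_left)
  then show ?thesis by (simp add: theta_coeff_def field_simps)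
qed

lemma theta_coeff_minus: "theta_coeff t (- j) = theta_coeff t j * exp (of_int j * t)"
  by (simp add: theta_coeff_def power_int_minus_left exp_add[symmetric] field_simps)

text \<open>The exponent is quadratic in the index, and polarisation produces the cross term
  \<open>i * j\<close>. This rule separates the variables in all coefficient comparisons
  below.\<close>

lemma theta_coeff_shift:
  "theta_coeff t (i + j) = theta_coeff t i * theta_coeff t j * exp (t * (of_int i * of_int j))"
proof -
  have "t * (of_int (i + j) * (of_int (i + j) - 1) / 2)
      = t * (of_int i * (of_int i - 1) / 2) + t * (of_int j * (of_int j - 1) / 2)
        + t * (of_int i * of_int j)"
    by (simp add: field_simps)
  then show ?thesis
    by (simp only: theta_coeff_def exp_add) (simp add: power_int_add)
qed

lemma theta_reflect: "theta t (t - a) = theta t a"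
  unfolding theta_def
  by (rule infsum_reindex_bij_witness[of _ uminus uminus])
     (auto simp: theta_coeff_minus exp_add[symmetric] algebra_simps)

text \<open>The involution \<open>j \<mapsto> 1 - 2 * b - j\<close> preserves the exponent and
  changes the parity of \<open>j\<close>, so the terms cancel in pairs.\<close>

lemma theta_int_multiple:
  assumes "Re t < 0"
  shows "theta t (of_int b * t) = 0"
proof -
  have "theta t (of_int b * t) = (\<Sum>\<^sub>\<infinity>j. - (theta_coeff t j * exp (of_int j * (of_int b * t))))"
    unfolding theta_def
  proof (rule infsum_reindex_bij_witness[of _ "\<lambda>j. 1 - 2 * b - j" "\<lambda>j. 1 - 2 * b - j"])
    show "- (theta_coeff t (1 - 2 * b - j) * exp (of_int (1 - 2 * b - j) * (of_int b * t)))
      = theta_coeff t j * exp (of_int j * (of_int b * t))" for j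
    proof -
      have "(-1) powi (1 - 2 * b - j) = - ((-1) powi j :: complex)"
        by (simp add: power_int_minus_left)
      then show ?thesis by (simp add: theta_coeff_def exp_add[symmetric] field_simps)
    qed
  qed auto
  then show ?thesis by (simp add: infsum_uminus theta_def)
qed

section \<open>Kronecker's identity and the reciprocal of the theta function\<close>

lemma rho_eq: "rho m n = (if 0 \<le> m \<and> 0 \<le> n then 1 else if m < 0 \<and> n < 0 then - 1 else 0)"
proof -
  have "sgn (real_of_int m + 1 / 2) = (if 0 \<le> m then 1 else - 1)" for m
  proof (cases "0 \<le> m")
    case False
    then have "real_of_int m \<le> - 1" by simp
    then show ?thesis using False by (simp add: sgn_if)
  qed (simp add: sgn_if)
  then show ?thesis by (auto simp: rho_def)
qed

lemma geometric_sum_powi: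
  fixes x :: "'a :: field"
  assumes "x \<noteq> 0" and "a \<le> b"
  shows "(1 - x) * (\<Sum>m\<in>{a..<b}. x powi m) = x powi a - x powi b"
  using assms(2)
proof (induction b rule: int_ge_induct)
  case (step b)
  then have "{a..<b + 1} = insert b {a..<b}" by auto
  then have "(1 - x) * (\<Sum>m\<in>{a..<b + 1}. x powi m) = (1 - x) * x powi b + (1 - x) * (\<Sum>m\<in>{a..<b}. x powi m)"
    by (simp add: distrib_left)
  also have "\<dots> = x powi a - x powi (b + 1)"
    unfolding step.IH using assms(1) by (simp add: power_int_add algebra_simps)
  finally show ?case .
qed simp

text \<open>On a line \<open>m + n = s\<close> only finitely many points lie in the two quadrants
  where \<open>rho\<close> is nonzero. With half-open intervals ending at \<open>s + 1\<close>, both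
  signs of \<open>s\<close> lead to the same closed geometric sum; for \<open>s = -1\<close> the
  line misses both quadrants.\<close>

lemma rho_diagonal_has_sum:
  fixes g :: "int \<Rightarrow> complex"
  shows "((\<lambda>m. of_real (rho m (s - m)) * g m) has_sum
    (if 0 \<le> s then \<Sum>m\<in>{0..<s + 1}. g m else - (\<Sum>m\<in>{s + 1..<0}. g m))) UNIV"
proof (rule has_sum_finite_neutralI)
  let ?B = "if 0 \<le> s then {0..<s + 1} else {s + 1..<0}"
  show "of_real (rho m (s - m)) * g m = 0" if "m \<in> UNIV - ?B" for m
    using that by (auto simp: rho_eq split: if_splits)
  show "(if 0 \<le> s then \<Sum>m\<in>{0..<s + 1}. g m else - (\<Sum>m\<in>{s + 1..<0}. g m))
      = (\<Sum>m\<in>?B. of_real (rho m (s - m)) * g m)"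
  proof (cases "0 \<le> s")
    case True
    then show ?thesis by (auto simp: rho_eq intro!: sum.cong)
  next
    case False
    then show ?thesis by (auto simp: rho_eq sum_negf[symmetric] intro!: sum.cong)
  qed
qed auto

lemma rho_diagonal_geometric:
  fixes x :: complex
  assumes "x \<noteq> 0" "x \<noteq> 1"
  shows "((\<lambda>m. of_real (rho m (s - m)) * x powi m) has_sum (1 - x powi (s + 1)) / (1 - x)) UNIV"
proof -
  have "(1 - x powi (s + 1)) / (1 - x)
      = (if 0 \<le> s then \<Sum>m\<in>{0..<s + 1}. x powi m else - (\<Sum>m\<in>{s + 1..<0}. x powi m))"
    using geometric_sum_powi[OF assms(1), of 0 "s + 1"] geometric_sum_powi[OF assms(1), of "s + 1" 0] assms(2)
    by (auto simp: field_simps)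
  then show ?thesis using rho_diagonal_has_sum[of s "\<lambda>m. x powi m"] by simp
qed

lemma rho_diagonal_count:
  "((\<lambda>m. of_real (rho m (s - m))) has_sum (of_int (s + 1) :: complex)) UNIV"
  using rho_diagonal_has_sum[of s "\<lambda>m. 1"] by (auto simp: add.commute split: if_splits)

text \<open>In Kronecker's series times theta(x) theta(y), this is what remains of the coefficient
  of x^a y^b after all factors independent of \<open>m\<close> and \<open>n\<close> are removed. The
  case \<open>b = 0\<close> occurs in the same way for the reciprocal theta function.\<close>

definition rho_theta_term :: "complex \<Rightarrow> int \<Rightarrow> int \<Rightarrow> int \<times> int \<Rightarrow> complex" where
  "rho_theta_term t a b = (\<lambda>(m, n). of_real (rho m n) * theta_coeff t (- (m + n))
     * exp (- t * (of_int a * of_int m + of_int b * of_int n)))"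

text \<open>The exponent of \<^const>\<open>rho_theta_term\<close> depends on \<open>m\<close> only linearly once \<open>s = m + n\<close> is fixed,
  so the inner sums over the lines \<open>m + n = s\<close> are finite geometric sums.\<close>

lemma rho_theta_has_sum:
  assumes t: "Re t < 0" and S: "rho_theta_term t a b summable_on UNIV"
  shows "(rho_theta_term t a b has_sum
    (if a = b then theta_coeff t a * exp (- t * (of_int a * (of_int a - 1))) * euler_phi (exp t) ^ 3 else 0)) UNIV"
proof -
  define x where "x = exp (- t * of_int (a - b))"
  define D :: "int \<Rightarrow> complex" where
    "D s = (if a = b then of_int (s + 1) else (1 - x powi (s + 1)) / (1 - x))" for s
  define c where "c s = theta_coeff t (- s) * exp (- t * (of_int b * of_int s)) * D s" for s
  have x0: "x \<noteq> 0" by (simp add: x_def)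
  have x1: "x \<noteq> 1" if "a \<noteq> b"
  proof
    assume "x = 1"
    then have "norm x = 1" by simp
    then have "Re (- t * of_int (a - b)) = 0" unfolding x_def norm_exp_eq_Re by simp
    then have "Re t * of_int (a - b) = 0" by simp
    then show False using t that by simp
  qed
  have xpow: "x powi m = exp (- t * of_int (a - b) * of_int m)" for m
    by (simp add: x_def exp_power_int mult_ac)
  have inner: "((\<lambda>m. rho_theta_term t a b (m, s - m)) has_sum c s) UNIV" for s
  proof -
    have "((\<lambda>m. of_real (rho m (s - m)) * x powi m) has_sum D s) UNIV"
      using rho_diagonal_geometric[OF x0 x1] rho_diagonal_count[of s]
      by (simp add: D_def x_def)
    then have "((\<lambda>m. theta_coeff t (- s) * exp (- t * (of_int b * of_int s))
        * (of_real (rho m (s - m)) * x powi m)) has_sum c s) UNIV"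
      unfolding c_def by (rule has_sum_cmult_right)
    moreover have "theta_coeff t (- s) * exp (- t * (of_int b * of_int s)) * (of_real (rho m (s - m)) * x powi m)
        = rho_theta_term t a b (m, s - m)" for m
    proof -
      have "- t * (of_int a * of_int m + of_int b * of_int (s - m))
          = - t * (of_int b * of_int s) + - t * of_int (a - b) * of_int m"
        by (simp add: algebra_simps)
      then show ?thesis
        unfolding rho_theta_term_def prod.case xpow by (simp only: exp_add) simp
    qed
    ultimately show ?thesis by simp
  qed
  have "((\<lambda>(s, m). rho_theta_term t a b (m, s - m)) has_sum infsum (rho_theta_term t a b) UNIV) (UNIV \<times> UNIV)
      \<longleftrightarrow> (rho_theta_term t a b has_sum infsum (rho_theta_term t a b) UNIV) UNIV"
    by (rule has_sum_reindex_bij_witness[of _ "\<lambda>(m, n). (m + n, m)" "\<lambda>(s, m). (m, s - m)"]) auto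
  then have "((\<lambda>(s, m). rho_theta_term t a b (m, s - m)) has_sum infsum (rho_theta_term t a b) UNIV) (UNIV \<times> UNIV)"
    using has_sum_infsum[OF S] by simp
  then have outer: "(c has_sum infsum (rho_theta_term t a b) UNIV) UNIV"
    by (rule has_sum_SigmaD) (use inner in simp)
  have th0: "((\<lambda>j. theta_coeff t j * exp (of_int j * (of_int d * t))) has_sum 0) UNIV" for d
    using theta_has_sum[OF t] theta_int_multiple[OF t] by metis
  have neg: "theta_coeff t (- s) = - theta_coeff t (s + 1)" for s
    using theta_coeff_reflect[of t "- s"] by (simp add: add.commute)
  have "(c has_sum (if a = b then theta_coeff t a * exp (- t * (of_int a * (of_int a - 1))) * euler_phi (exp t) ^ 3
      else 0)) UNIV"
  proof (cases "a = b")
    case False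
    \<comment> \<open>With \<open>j = s + 1\<close>, the numerator \<open>1 - x powi (s + 1)\<close>
      splits the sum over the lines into theta series at \<open>- b * t\<close> and
      \<open>- a * t\<close>, and both vanish.\<close>
    have "((\<lambda>j. - (exp (of_int b * t) / (1 - x)) * (theta_coeff t j * exp (of_int j * (of_int (- b) * t))
        - theta_coeff t j * exp (of_int j * (of_int (- a) * t)))) has_sum - (exp (of_int b * t) / (1 - x)) * (0 - 0)) UNIV"
      using has_sum_add[OF th0[of "- b"] has_sum_uminusI[OF th0[of "- a"]]]
      by (intro has_sum_cmult_right) simp
    then have *: "((\<lambda>j. - (exp (of_int b * t) / (1 - x)) * (theta_coeff t j * exp (of_int j * (of_int (- b) * t))
        - theta_coeff t j * exp (of_int j * (of_int (- a) * t)))) has_sum 0) UNIV" by simp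
    have "(c has_sum 0) UNIV"
    proof (rule has_sum_reindex_bij_witness[of UNIV "\<lambda>j. j - 1" "\<lambda>s. s + 1" UNIV, THEN iffD2, OF _ _ _ _ _ _ *])
      fix s
      have e1: "exp (of_int b * t) * exp (of_int (s + 1) * (of_int (- b) * t)) = exp (- t * (of_int b * of_int s))"
        by (simp add: exp_add[symmetric] algebra_simps)
      have "exp (of_int (s + 1) * (of_int (- a) * t)) = exp (of_int (s + 1) * (of_int (- b) * t)) * x powi (s + 1)"
        unfolding xpow exp_add[symmetric] by (simp add: algebra_simps)
      then have "- (exp (of_int b * t) / (1 - x)) * (theta_coeff t (s + 1) * exp (of_int (s + 1) * (of_int (- b) * t))
          - theta_coeff t (s + 1) * exp (of_int (s + 1) * (of_int (- a) * t)))
        = - theta_coeff t (s + 1) * (exp (of_int b * t) * exp (of_int (s + 1) * (of_int (- b) * t)))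
          * ((1 - x powi (s + 1)) / (1 - x))"
        by (simp only:) (simp add: algebra_simps diff_divide_distrib)
      then show "- (exp (of_int b * t) / (1 - x)) * (theta_coeff t (s + 1) * exp (of_int (s + 1) * (of_int (- b) * t))
          - theta_coeff t (s + 1) * exp (of_int (s + 1) * (of_int (- a) * t))) = c s"
        unfolding e1 c_def neg D_def using False by simp
    qed auto
    then show ?thesis using False by simp
  next
    case True
    define C where "C = theta_coeff t a * exp (- t * (of_int a * (of_int a - 1)))"
    \<comment> \<open>The substitution \<open>s + 1 = j + a\<close> turns the number
      \<open>s + 1\<close> of points on a line into \<open>j + a\<close>: the part with
      \<open>j\<close> is Jacobi's series, the part with \<open>a\<close> a multiple of theta at 0,
      which vanishes.\<close>
    have "((\<lambda>j. - C * (theta_coeff t j * of_int j + of_int a * (theta_coeff t j * exp (of_int j * (of_int 0 * t)))))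
        has_sum - C * (- (euler_phi (exp t) ^ 3) + of_int a * 0)) UNIV"
      by (intro has_sum_cmult_right has_sum_add th0 jacobi_cube_identity t)
    then have *: "((\<lambda>j. - C * (theta_coeff t j * of_int j + of_int a * (theta_coeff t j * exp (of_int j * (of_int 0 * t)))))
        has_sum C * euler_phi (exp t) ^ 3) UNIV" by simp
    have "(c has_sum C * euler_phi (exp t) ^ 3) UNIV"
    proof (rule has_sum_reindex_bij_witness[of UNIV "\<lambda>j. j + a - 1" "\<lambda>s. s + 1 - a" UNIV, THEN iffD2, OF _ _ _ _ _ _ *])
      fix s
      define j where "j = s + 1 - a"
      have s: "s = j + a - 1" by (simp add: j_def)
      have "theta_coeff t (s + 1) * exp (- t * (of_int b * of_int s))
          = theta_coeff t j * theta_coeff t a * (exp (t * (of_int j * of_int a)) * exp (- t * (of_int b * of_int s)))"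
        unfolding s by (simp add: theta_coeff_shift)
      also have "exp (t * (of_int j * of_int a)) * exp (- t * (of_int b * of_int s))
          = exp (- t * (of_int a * (of_int a - 1)))"
        unfolding exp_add[symmetric] s using True by (simp add: algebra_simps)
      finally have "theta_coeff t (s + 1) * exp (- t * (of_int b * of_int s)) = C * theta_coeff t j"
        by (simp add: C_def)
      then have "c s = - C * (theta_coeff t j * (of_int (s + 1)))"
        unfolding c_def neg D_def using True by simp
      also have "\<dots> = - C * (theta_coeff t j * of_int j + of_int a * (theta_coeff t j * exp (of_int j * (of_int 0 * t))))"
        by (simp add: s algebra_simps)
      finally show "- C * (theta_coeff t (s + 1 - a) * of_int (s + 1 - a)
          + of_int a * (theta_coeff t (s + 1 - a) * exp (of_int (s + 1 - a) * (of_int 0 * t)))) = c s"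
        unfolding j_def by simp
    qed auto
    then show ?thesis using True by (simp add: C_def)
  qed
  then have "infsum (rho_theta_term t a b) UNIV
      = (if a = b then theta_coeff t a * exp (- t * (of_int a * (of_int a - 1))) * euler_phi (exp t) ^ 3 else 0)"
    using outer has_sum_unique by blast
  then show ?thesis using has_sum_infsum[OF S] by simp
qed

text \<open>Each quadrant uses one side of the hypotheses. For nonnegative indices
  \<open>T * m * n\<close> is dropped and \<open>a, b < 0\<close> give the decay. For negative ones,
  put \<open>u = - m\<close> and \<open>v = - n\<close>; then \<open>u * v \<ge> u + v - 1\<close>,
  and \<open>T < a\<close>, \<open>T < b\<close> give the decay, at the cost of a constant
  \<open>- T\<close>.\<close>

lemma summable_rho_exp:
  fixes T a b :: real
  assumes "T < a" "a < 0" "T < b" "b < 0"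
  shows "(\<lambda>(m, n). \<bar>rho m n\<bar> * exp (T * (of_int m * of_int n) + a * of_int m + b * of_int n)) summable_on UNIV"
proof -
  define g where "g = max (max a b) (max (T - a) (T - b))"
  have g: "g < 0" "a \<le> g" "b \<le> g" "T - a \<le> g" "T - b \<le> g"
    using assms by (auto simp: g_def)
  define C where "C = max 0 (- T)"
  let ?e = "\<lambda>j::int. exp (g * of_int \<bar>j\<bar>)"
  have sm: "?e summable_on UNIV" by (rule summable_exp_abs_int[OF g(1)])
  have prod: "(\<lambda>(m, n). ?e m * ?e n) summable_on UNIV \<times> UNIV"
    by (rule summable_on_SigmaI[where g = "\<lambda>m. ?e m * infsum ?e UNIV"])
       (use sm in \<open>auto intro!: has_sum_cmult_right summable_on_cmult_left has_sum_infsum\<close>)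
  show ?thesis
  proof (rule summable_on_comparison_test)
    show "(\<lambda>p. exp C * (case p of (m, n) \<Rightarrow> ?e m * ?e n)) summable_on UNIV"
      using prod by (intro summable_on_cmult_right) simp
    fix p :: "int \<times> int"
    obtain m n where p: "p = (m, n)" by (cases p)
    have le: "T * (of_int m * of_int n) + a * of_int m + b * of_int n
        \<le> C + (g * of_int \<bar>m\<bar> + g * of_int \<bar>n\<bar>)" if "rho m n \<noteq> 0"
    proof -
      consider "0 \<le> m" "0 \<le> n" | "m < 0" "n < 0"
        using \<open>rho m n \<noteq> 0\<close> by (auto simp: rho_eq split: if_splits)
      then show ?thesis
      proof cases
        case 1
        have "T * (of_int m * of_int n) \<le> 0"
          using assms 1 by (intro mult_nonpos_nonneg) auto
        moreover have "a * of_int m \<le> g * of_int m" "b * of_int n \<le> g * of_int n"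
          using 1 g by (auto intro!: mult_right_mono)
        ultimately show ?thesis using 1 by (simp add: C_def)
      next
        case 2
        define u v :: real where "u = - of_int m" and "v = - of_int n"
        have uv: "1 \<le> u" "1 \<le> v" using 2 by (simp_all add: u_def v_def)
        have "0 \<le> (u - 1) * (v - 1)" using uv by simp
        then have "u + v - 1 \<le> u * v" by (simp add: algebra_simps)
        then have "T * (u * v) \<le> T * (u + v - 1)"
          using assms by (intro mult_left_mono_neg) auto
        moreover have "(T - a) * u \<le> g * u" "(T - b) * v \<le> g * v"
          using uv g by (auto intro!: mult_right_mono)
        moreover have "of_int \<bar>m\<bar> = u" "of_int \<bar>n\<bar> = v" "of_int m = - u" "of_int n = - v"
          using 2 by (simp_all add: u_def v_def)
        ultimately show ?thesis by (simp add: C_def algebra_simps)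
      qed
    qed
    have "\<bar>rho m n\<bar> * exp (T * (of_int m * of_int n) + a * of_int m + b * of_int n)
        \<le> exp (C + (g * of_int \<bar>m\<bar> + g * of_int \<bar>n\<bar>))"
    proof (cases "rho m n = 0")
      case False
      then have "\<bar>rho m n\<bar> = 1" by (auto simp: rho_eq split: if_splits)
      then show ?thesis using le[OF False] by simp
    qed simp
    then show "(case p of (m, n) \<Rightarrow> \<bar>rho m n\<bar> * exp (T * (of_int m * of_int n) + a * of_int m + b * of_int n))
        \<le> exp C * (case p of (m, n) \<Rightarrow> ?e m * ?e n)"
      by (simp add: p exp_add)
  qed auto
qed

definition kronecker_term :: "complex \<Rightarrow> complex \<Rightarrow> complex \<Rightarrow> int \<times> int \<Rightarrow> complex" where
  "kronecker_term t a b = (\<lambda>(m, n). of_real (rho m n) * exp (t * (of_int m * of_int n) + a * of_int m + b * of_int n))"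

text \<open>Summation over \<open>m\<close> yields the partial fractions (-1)^n q^(n(n+1)/2) / (1 -
  x q^n), with x = \<open>exp a\<close>. For |q| < |x| < 1 one has |x q^n| < 1 exactly when n \<ge>
  0, and \<open>rho\<close> selects the geometric expansion accordingly.\<close>

definition reciprocal_theta_term :: "complex \<Rightarrow> complex \<Rightarrow> int \<times> int \<Rightarrow> complex" where
  "reciprocal_theta_term t a = (\<lambda>(n, m). of_real (rho n m) * theta_coeff t (- n) * exp (t * (of_int n * of_int m) + a * of_int m))"

lemma summable_kronecker_term:
  assumes "Re t < Re a" "Re a < 0" "Re t < Re b" "Re b < 0"
  shows "kronecker_term t a b summable_on UNIV"
proof (rule abs_summable_summable)
  have "norm (kronecker_term t a b p)
      = (case p of (m, n) \<Rightarrow> \<bar>rho m n\<bar> * exp (Re t * (of_int m * of_int n) + Re a * of_int m + Re b * of_int n))" for p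
    by (cases p) (simp add: kronecker_term_def norm_mult norm_exp_eq_Re)
  then show "(\<lambda>p. norm (kronecker_term t a b p)) summable_on UNIV"
    using summable_rho_exp[OF assms] by simp
qed

text \<open>Dropping the quadratic part of the Gaussian exponent in \<open>n\<close> only enlarges
  the terms. What is left has the linear rate \<open>Re t / 2\<close>, which lies between
  \<open>Re t\<close> and 0 as the majorant requires.\<close>

lemma summable_reciprocal_theta_term:
  assumes "Re t < Re a" "Re a < 0"
  shows "reciprocal_theta_term t a summable_on UNIV"
proof (rule abs_summable_summable, rule Infinite_Sum.abs_summable_on_comparison_test')
  show "(\<lambda>(n, m). \<bar>rho n m\<bar> * exp (Re t * (of_int n * of_int m) + (Re t / 2) * of_int n + Re a * of_int m)) summable_on UNIV"
    using assms by (intro summable_rho_exp) auto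
  fix p :: "int \<times> int"
  obtain n m where p: "p = (n, m)" by (cases p)
  have "norm (reciprocal_theta_term t a p) = \<bar>rho n m\<bar> * exp (Re t * (of_int (- n) * (of_int (- n) - 1) / 2)
      + (Re t * (of_int n * of_int m) + Re a * of_int m))"
    by (simp add: p reciprocal_theta_term_def norm_mult norm_theta_coeff norm_exp_eq_Re mult.assoc exp_add[symmetric])
  also have "\<dots> \<le> \<bar>rho n m\<bar> * exp (Re t * (of_int n * of_int m) + (Re t / 2) * of_int n + Re a * of_int m)"
  proof -
    have "Re t * (of_int n)\<^sup>2 \<le> 0" using assms by (intro mult_nonpos_nonneg) auto
    then show ?thesis by (intro mult_left_mono) (auto simp: field_simps power2_eq_square)
  qed
  finally show "norm (reciprocal_theta_term t a p)
      \<le> (case p of (n, m) \<Rightarrow> \<bar>rho n m\<bar> * exp (Re t * (of_int n * of_int m) + (Re t / 2) * of_int n + Re a * of_int m))"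
    by (simp add: p)
qed

lemma rho_commute: "rho m n = rho n m"
  by (simp add: rho_def add.commute)

lemma theta_coeff_diff:
  "theta_coeff t (i - j) = theta_coeff t i * theta_coeff t (- j) * exp (- t * (of_int i * of_int j))"
  using theta_coeff_shift[of t i "- j"] by simp

text \<open>After multiplication with the theta series, the terms are grouped by the total power
  \<open>l = m + j\<close> of \<open>exp a\<close>. The coefficient is a multiple of the sum of
  \<open>rho_theta_term t l 0\<close>, which vanishes unless \<open>l = 0\<close>.\<close>

lemma reciprocal_theta_identity:
  assumes "Re t < Re a" "Re a < 0"
  shows "infsum (reciprocal_theta_term t a) UNIV * theta t a = euler_phi (exp t) ^ 3"
proof -
  have t: "Re t < 0" using assms by simp
  let ?R = "reciprocal_theta_term t a"
  define h where "h = (\<lambda>(l, m, n). theta_coeff t l * exp (of_int l * a) * rho_theta_term t l 0 (m, n))"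
  have "((\<lambda>(p, j). ?R p * (theta_coeff t j * exp (of_int j * a))) has_sum infsum ?R UNIV * theta t a) (UNIV \<times> UNIV)"
    by (intro has_sum_times_complex has_sum_infsum summable_reciprocal_theta_term theta_has_sum assms t)
  moreover have "((\<lambda>(p, j). ?R p * (theta_coeff t j * exp (of_int j * a))) has_sum infsum ?R UNIV * theta t a) (UNIV \<times> UNIV)
      \<longleftrightarrow> (h has_sum infsum ?R UNIV * theta t a) (UNIV \<times> UNIV)"
  proof (rule has_sum_reindex_bij_witness[of _ "\<lambda>(l, m, n). ((n, m), l - m)" "\<lambda>((n, m), j). (m + j, m, n)"])
    fix z :: "(int \<times> int) \<times> int" 
    obtain n m j where z: "z = ((n, m), j)" by (metis prod.exhaust)
    define l where "l = m + j"
    have j: "j = l - m" by (simp add: l_def)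
    have "exp (of_int l * a) = exp (a * of_int m) * exp (of_int j * a)"
      unfolding l_def exp_add[symmetric] by (simp add: algebra_simps)
    moreover have "theta_coeff t j = theta_coeff t l * theta_coeff t (- m) * exp (- t * (of_int l * of_int m))"
      unfolding j by (rule theta_coeff_diff)
    moreover have "theta_coeff t (- (m + n)) = theta_coeff t (- m) * theta_coeff t (- n) * exp (t * (of_int n * of_int m))"
      using theta_coeff_shift[of t "- m" "- n"] by (simp add: mult.commute)
    ultimately show "h ((\<lambda>((n, m), j). (m + j, m, n)) z) = (case z of (p, j) \<Rightarrow> ?R p * (theta_coeff t j * exp (of_int j * a)))"
      unfolding z prod.case l_def[symmetric] h_def rho_theta_term_def reciprocal_theta_term_def exp_add
      by (simp add: rho_commute[of m n])
  qed auto
  ultimately have H: "(h has_sum infsum ?R UNIV * theta t a) (UNIV \<times> UNIV)" by simp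
  have inner: "((\<lambda>p. h (l, p)) has_sum (if l = 0 then euler_phi (exp t) ^ 3 else 0)) UNIV" for l
  proof -
    \<comment> \<open>The fibre inherits summability from the total family; its nonzero factor
      depending on \<open>l\<close> alone can then be divided out.\<close>
    have "(\<lambda>p. h (l, p)) summable_on UNIV"
      using summable_on_SigmaD1[of "\<lambda>l p. h (l, p)" UNIV "\<lambda>_. UNIV" l] has_sum_imp_summable[OF H] by simp
    then have "(\<lambda>p. theta_coeff t l * exp (of_int l * a) * rho_theta_term t l 0 p) summable_on UNIV"
      by (simp add: h_def case_prod_unfold)
    then have S: "rho_theta_term t l 0 summable_on UNIV"
      by (subst (asm) summable_on_cmult_right') (simp_all add: theta_coeff_def)
    have "((\<lambda>p. theta_coeff t l * exp (of_int l * a) * rho_theta_term t l 0 p) has_sum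
        (theta_coeff t l * exp (of_int l * a) * (if l = 0 then theta_coeff t l * exp (- t * (of_int l * (of_int l - 1))) * euler_phi (exp t) ^ 3 else 0))) UNIV"
      by (intro has_sum_cmult_right rho_theta_has_sum t S)
    moreover have "theta_coeff t l * exp (of_int l * a) * (if l = 0 then theta_coeff t l * exp (- t * (of_int l * (of_int l - 1))) * euler_phi (exp t) ^ 3 else 0)
        = (if l = 0 then euler_phi (exp t) ^ 3 else 0)"
      by (simp add: theta_coeff_def)
    ultimately show ?thesis by (simp add: h_def case_prod_unfold)
  qed
  have "((\<lambda>l::int. if l = 0 then euler_phi (exp t) ^ 3 else 0) has_sum infsum ?R UNIV * theta t a) UNIV"
    by (rule has_sum_SigmaD[OF H]) (rule inner)
  moreover have "((\<lambda>l::int. if l = 0 then euler_phi (exp t) ^ 3 else 0) has_sum euler_phi (exp t) ^ 3) UNIV"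
    by (rule has_sum_finite_neutralI[of "{0}"]) auto
  ultimately show ?thesis by (rule has_sum_unique)
qed

text \<open>A convergent series times \<open>theta t a\<close> equals a nonzero Euler product, which
  rules out a zero in the annulus.\<close>

lemma theta_nonzero:
  assumes "Re t < Re a" "Re a < 0"
  shows "theta t a \<noteq> 0"
  using reciprocal_theta_identity[OF assms] euler_phi_nz[of "exp t"] assms by auto

text \<open>Grouping by the powers \<open>k\<close> of \<open>exp a\<close> and \<open>l\<close> of
  \<open>exp b\<close> leaves multiples of the sums of \<open>rho_theta_term t k l\<close>. They
  vanish off the diagonal, and the diagonal is a theta series at \<open>a + b\<close>.\<close>

lemma kronecker_identity:
  assumes "Re t < Re a" "Re a < 0" "Re t < Re b" "Re b < 0"
  shows "infsum (kronecker_term t a b) UNIV * (theta t a * theta t b) = euler_phi (exp t) ^ 3 * theta t (a + b)"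
proof -
  have t: "Re t < 0" using assms by simp
  let ?K = "kronecker_term t a b"
  let ?f = "\<lambda>(p, i, j). ?K p * ((theta_coeff t i * exp (of_int i * a)) * (theta_coeff t j * exp (of_int j * b)))"
  let ?V = "infsum ?K UNIV * (theta t a * theta t b)"
  define A where "A = (\<lambda>(k, l). theta_coeff t k * theta_coeff t l * exp (of_int k * a) * exp (of_int l * b))"
  define h where "h = (\<lambda>((k, l), p). A (k, l) * rho_theta_term t k l p)"
  define E where "E k = theta_coeff t k * exp (of_int k * (a + b))" for k
  have "(?f has_sum ?V) (UNIV \<times> UNIV)"
    using has_sum_times_complex[OF has_sum_infsum[OF summable_kronecker_term[OF assms]]
        has_sum_times_complex[OF theta_has_sum[OF t, of a] theta_has_sum[OF t, of b]]]
    by (simp add: case_prod_unfold)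
  moreover have "(?f has_sum ?V) (UNIV \<times> UNIV) \<longleftrightarrow> (h has_sum ?V) (UNIV \<times> UNIV)"
  proof (rule has_sum_reindex_bij_witness[of _ "\<lambda>((k, l), (m, n)). ((m, n), k - m, l - n)"
          "\<lambda>((m, n), i, j). ((m + i, n + j), (m, n))"])
    fix z :: "(int \<times> int) \<times> int \<times> int"
    obtain m n i j where z: "z = ((m, n), i, j)" by (metis prod.exhaust)
    define k l where "k = m + i" and "l = n + j"
    have ij: "i = k - m" "j = l - n" by (simp_all add: k_def l_def)
    have "exp (of_int k * a) = exp (a * of_int m) * exp (of_int i * a)"
      unfolding k_def exp_add[symmetric] by (simp add: algebra_simps)
    moreover have "exp (of_int l * b) = exp (b * of_int n) * exp (of_int j * b)"
      unfolding l_def exp_add[symmetric] by (simp add: algebra_simps)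
    moreover have "theta_coeff t i = theta_coeff t k * theta_coeff t (- m) * exp (- t * (of_int k * of_int m))"
      unfolding ij by (rule theta_coeff_diff)
    moreover have "theta_coeff t j = theta_coeff t l * theta_coeff t (- n) * exp (- t * (of_int l * of_int n))"
      unfolding ij by (rule theta_coeff_diff)
    moreover have "theta_coeff t (- (m + n)) = theta_coeff t (- m) * theta_coeff t (- n) * exp (t * (of_int m * of_int n))"
      using theta_coeff_shift[of t "- m" "- n"] by simp
    moreover have "exp (- t * (of_int k * of_int m + of_int l * of_int n))
        = exp (- t * (of_int k * of_int m)) * exp (- t * (of_int l * of_int n))"
      unfolding exp_add[symmetric] by (simp add: algebra_simps)
    ultimately show "h ((\<lambda>((m, n), i, j). ((m + i, n + j), (m, n))) z) = ?f z"
      unfolding z prod.case k_def[symmetric] l_def[symmetric] h_def rho_theta_term_def kronecker_term_def A_def exp_add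
      by simp
  qed auto
  ultimately have H: "(h has_sum ?V) (UNIV \<times> UNIV)" by simp
  let ?c = "\<lambda>(k, l). if k = l then euler_phi (exp t) ^ 3 * E k else 0"
  have inner: "((\<lambda>p. h ((k, l), p)) has_sum ?c (k, l)) UNIV" for k l
  proof -
    have "(\<lambda>p. h ((k, l), p)) summable_on UNIV"
      using summable_on_SigmaD1[of "\<lambda>kl p. h (kl, p)" UNIV "\<lambda>_. UNIV" "(k, l)"] has_sum_imp_summable[OF H] by simp
    then have "(\<lambda>p. A (k, l) * rho_theta_term t k l p) summable_on UNIV"
      by (simp add: h_def)
    then have S: "rho_theta_term t k l summable_on UNIV"
      by (subst (asm) summable_on_cmult_right') (simp_all add: A_def theta_coeff_def)
    \<comment> \<open>The diagonal term carries \<open>theta_coeff t k\<close> three times: two from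
      the theta functions, one from \<open>rho_theta_has_sum\<close>. Two of them cancel against the
      exponential, which leaves the single one of a theta series.\<close>
    have sq: "theta_coeff t k * theta_coeff t k * exp (- t * (of_int k * (of_int k - 1))) = 1"
    proof -
      have "theta_coeff t k * theta_coeff t k = ((-1) powi k * (-1) powi k)
          * (exp (t * (of_int k * (of_int k - 1) / 2)) * exp (t * (of_int k * (of_int k - 1) / 2)))"
        unfolding theta_coeff_def by (simp only: mult_ac)
      also have "\<dots> = exp (t * (of_int k * (of_int k - 1)))"
        unfolding exp_add[symmetric] by simp
      finally have "theta_coeff t k * theta_coeff t k = exp (t * (of_int k * (of_int k - 1)))" .
      then show ?thesis by (simp add: exp_add[symmetric])
    qed
    have "((\<lambda>p. A (k, l) * rho_theta_term t k l p) has_sum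
        (A (k, l) * (if k = l then theta_coeff t k * exp (- t * (of_int k * (of_int k - 1))) * euler_phi (exp t) ^ 3 else 0))) UNIV"
      by (intro has_sum_cmult_right rho_theta_has_sum t S)
    moreover have "A (k, l) * (if k = l then theta_coeff t k * exp (- t * (of_int k * (of_int k - 1))) * euler_phi (exp t) ^ 3 else 0)
        = ?c (k, l)"
    proof -
      have "A (k, k) * (theta_coeff t k * exp (- t * (of_int k * (of_int k - 1))) * euler_phi (exp t) ^ 3)
          = (theta_coeff t k * theta_coeff t k * exp (- t * (of_int k * (of_int k - 1))))
            * (euler_phi (exp t) ^ 3 * (theta_coeff t k * (exp (of_int k * a) * exp (of_int k * b))))"
        by (simp add: A_def mult_ac)
      also have "\<dots> = euler_phi (exp t) ^ 3 * E k"
        unfolding sq E_def by (simp add: distrib_left exp_add)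
      finally show ?thesis by auto
    qed
    ultimately show ?thesis by (simp add: h_def)
  qed
  have "(?c has_sum ?V) UNIV"
  proof (rule has_sum_SigmaD[OF H])
    show "((\<lambda>p. h (x, p)) has_sum ?c x) UNIV" for x
      using inner[of "fst x" "snd x"] by (simp only: prod.collapse)
  qed
  moreover have "(?c has_sum euler_phi (exp t) ^ 3 * theta t (a + b)) UNIV"
  proof -
    have "((\<lambda>k. euler_phi (exp t) ^ 3 * E k) has_sum euler_phi (exp t) ^ 3 * theta t (a + b)) UNIV"
      unfolding E_def by (intro has_sum_cmult_right theta_has_sum t)
    also have "?this \<longleftrightarrow> (?c has_sum euler_phi (exp t) ^ 3 * theta t (a + b)) (range (\<lambda>k. (k, k)))"
      by (subst has_sum_reindex) (auto simp: inj_on_def o_def)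
    also have "\<dots> \<longleftrightarrow> (?c has_sum euler_phi (exp t) ^ 3 * theta t (a + b)) UNIV"
      by (rule has_sum_cong_neutral) auto
    finally show ?thesis .
  qed
  ultimately show ?thesis by (rule has_sum_unique)
qed

section \<open>Uniqueness of Laurent coefficients\<close>

lemma has_sum_sum_finite:
  fixes f :: "'i \<Rightarrow> 'a \<Rightarrow> complex"
  assumes "finite I" and "\<And>i. i \<in> I \<Longrightarrow> (f i has_sum s i) A"
  shows "((\<lambda>x. \<Sum>i\<in>I. f i x) has_sum (\<Sum>i\<in>I. s i)) A"
  using assms by (induction I rule: finite_induct) (auto intro!: has_sum_add)

text \<open>Averaging over the \<open>N\<close>-th roots of unity isolates the coefficients with index congruent to
  \<open>a\<close> modulo \<open>N\<close>; in the limit only the coefficient with index \<open>a\<close> survives.\<close>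

lemma laurent_series_zero_on_circle:
  fixes c :: "int \<Rightarrow> complex"
  assumes r: "r > 0" and zero: "\<And>w. norm w = r \<Longrightarrow> ((\<lambda>n. c n * w powi n) has_sum 0) UNIV"
  shows "c a = 0"
proof -
  define b where "b n = c n * of_real r powi n" for n
  have b: "((\<lambda>n. b n * w powi n) has_sum 0) UNIV" if "norm w = 1" for w
    using zero[of "of_real r * w"] that r by (simp add: b_def norm_mult power_int_mult_distrib mult.assoc)
  have "(\<lambda>n. norm (b n)) summable_on UNIV"
    using b[of 1] has_sum_imp_summable summable_on_iff_abs_summable_on_complex by force
  \<comment> \<open>The average of w^(n - a) over the roots of unity w of order
    \<open>Suc N\<close>, times \<open>b n\<close>; the successor keeps the order positive.\<close>
  define f where "f N n = (\<Sum>j<Suc N. cis (2 * pi * of_int (n - a) / real (Suc N)) ^ j) / of_nat (Suc N) * b n" for N n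
  have "(\<lambda>N. infsum (f N) UNIV) \<longlonglongrightarrow> infsum (\<lambda>n. if n = a then b n else 0) UNIV"
  proof (rule infsum_tendsto_dominated)
    fix n
    have "\<forall>\<^sub>F N in sequentially. (if n = a then b n else 0) = f N n"
    \<comment> \<open>Once \<open>\<bar>n - a\<bar> < Suc N\<close>, the index \<open>n\<close> is
      congruent to \<open>a\<close> modulo \<open>Suc N\<close> only if
      \<open>n = a\<close>.\<close>
    proof (rule eventually_sequentiallyI[of "nat \<bar>n - a\<bar>"])
      fix N assume N: "nat \<bar>n - a\<bar> \<le> N"
      show "(if n = a then b n else 0) = f N n"
      proof (cases "n = a")
        case False
        define x where "x = cis (2 * pi * of_int (n - a) / real (Suc N))"
        have ne: "x \<noteq> 1"
        proof
          assume "x = 1"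
          then obtain m :: int where "2 * pi * of_int (n - a) / real (Suc N) = of_int (2 * m) * pi"
            unfolding x_def cis_conv_exp exp_eq_1 by auto
          then have "(2 * pi) * real_of_int (n - a) = (2 * pi) * of_int (m * int (Suc N))"
            by (simp add: field_simps)
          then have "real_of_int (n - a) = of_int (m * int (Suc N))"
            by (rule mult_left_cancel[THEN iffD1, rotated]) simp
          then have eq: "n - a = m * int (Suc N)" by linarith
          then have "m \<noteq> 0" using False by auto
          then have "int (Suc N) \<le> \<bar>n - a\<bar>"
            unfolding eq abs_mult by (simp add: mult_le_cancel_right1)
          then show False using N by linarith
        qed
        have one: "x ^ Suc N = 1"
        proof -
          have "real (Suc N) * (2 * pi * of_int (n - a) / real (Suc N)) = 2 * pi * of_int (n - a)" by simp
          then have "x ^ Suc N = cis (2 * pi * of_int (n - a))"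
            unfolding x_def Complex.DeMoivre by (rule arg_cong)
          also have "\<dots> = 1" by (rule cis_multiple_2pi) simp
          finally show ?thesis .
        qed
        have "(\<Sum>j<Suc N. x ^ j) = (x ^ Suc N - 1) / (x - 1)" by (rule geometric_sum[OF ne])
        also have "\<dots> = 0" unfolding one by simp
        finally show ?thesis using False unfolding f_def x_def[symmetric] by simp
      qed (simp add: f_def del: of_nat_Suc sum.lessThan_Suc)
    qed
    then show "(\<lambda>N. f N n) \<longlonglongrightarrow> (if n = a then b n else 0)"
      by (rule Lim_transform_eventually[OF tendsto_const])
  next
    fix N n
    have "norm (\<Sum>j<Suc N. cis (2 * pi * of_int (n - a) / real (Suc N)) ^ j) \<le> (\<Sum>j<Suc N. 1)"
      by (rule sum_norm_le) (simp add: norm_power)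
    then have "norm ((\<Sum>j<Suc N. cis (2 * pi * of_int (n - a) / real (Suc N)) ^ j) / of_nat (Suc N)) \<le> 1"
      by (simp add: norm_divide del: of_nat_Suc sum.lessThan_Suc)
    then show "norm (f N n) \<le> norm (b n)"
      unfolding f_def norm_mult by (rule mult_left_le_one_le[OF norm_ge_zero norm_ge_zero])
  qed fact
  moreover have "infsum (f N) UNIV = 0" for N
  proof -
    define w where "w j = cis (2 * pi * real j / real (Suc N))" for j
    have "((\<lambda>n. \<Sum>j<Suc N. (b n * w j powi n) * (w j powi (- a) / of_nat (Suc N)))
        has_sum (\<Sum>j<Suc N. 0 * (w j powi (- a) / of_nat (Suc N)))) UNIV"
      by (intro has_sum_sum_finite has_sum_cmult_left b) (simp_all add: w_def)
    moreover have "(\<Sum>j<Suc N. (b n * w j powi n) * (w j powi (- a) / of_nat (Suc N))) = f N n" for n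
    proof -
      have "cis (2 * pi * of_int (n - a) / real (Suc N)) ^ j = w j powi n * w j powi (- a)" for j
      proof -
        have "real j * (2 * pi * of_int (n - a) / real (Suc N))
            = of_int n * (2 * pi * real j / real (Suc N)) + of_int (- a) * (2 * pi * real j / real (Suc N))"
          by (simp add: add_divide_distrib[symmetric] algebra_simps del: of_nat_Suc)
        then show ?thesis
          unfolding w_def cis_power_int Complex.DeMoivre cis_mult by (rule arg_cong)
      qed
      then have "f N n = (\<Sum>j<Suc N. w j powi n * w j powi (- a) / of_nat (Suc N) * b n)"
        unfolding f_def by (simp only: sum_divide_distrib sum_distrib_right)
      also have "\<dots> = (\<Sum>j<Suc N. (b n * w j powi n) * (w j powi (- a) / of_nat (Suc N)))"
        by (rule sum.cong) (simp_all only: times_divide_eq_right times_divide_eq_left mult_ac)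
      finally show ?thesis by (rule sym)
    qed
    ultimately have "(f N has_sum 0) UNIV" by (simp only: mult_zero_left sum.neutral_const)
    then show ?thesis by (rule infsumI)
  qed
  moreover have "infsum (\<lambda>n. if n = a then b n else 0) UNIV = b a"
    by (rule infsumI, rule has_sum_finite_neutralI[of "{a}"]) auto
  ultimately have "(\<lambda>N::nat. 0) \<longlonglongrightarrow> b a" by simp
  then have "b a = 0" using LIMSEQ_unique tendsto_const by blast
  then show ?thesis using r by (simp add: b_def)
qed

lemma surj_zeta_var: 
  assumes "w \<noteq> 0"
  shows "\<exists>z. zeta_var z = w"
proof
  show "zeta_var (Ln w / (2 * of_real pi * \<i>)) = w"
    using assms by (simp add: zeta_var_def)
qed

text \<open>A single torus suffices: the one-variable result is applied in the first variable to the
  row sums at fixed \<open>w2\<close>, and then in the second variable to each row.\<close>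

lemma laurent_expansion_unique:
  assumes c: "laurent_expansion f D c" and c': "laurent_expansion f D c'"
    and r: "r > 0" and D: "\<And>w1 w2. norm w1 = r \<Longrightarrow> norm w2 = r \<Longrightarrow> (w1, w2) \<in> D"
  shows "c = c'"
proof -
  define d where "d p = c p - c' p" for p
  have zero: "((\<lambda>(r1, r2). d (r1, r2) * w1 powi r1 * w2 powi r2) has_sum 0) (UNIV \<times> UNIV)"
    if w: "norm w1 = r" "norm w2 = r" for w1 w2
  proof -
    have "w1 \<noteq> 0" "w2 \<noteq> 0" using w r by auto
    then obtain z1 z2 where z: "w1 = zeta_var z1" "w2 = zeta_var z2" using surj_zeta_var by metis
    have "((\<lambda>(r1, r2). c (r1, r2) * w1 powi r1 * w2 powi r2) has_sum f z1 z2) UNIV"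
      and "((\<lambda>(r1, r2). c' (r1, r2) * w1 powi r1 * w2 powi r2) has_sum f z1 z2) UNIV"
      using c c' D[OF w] unfolding laurent_expansion_def z by blast+
    from has_sum_add[OF this(1) has_sum_uminusI[OF this(2)]] show ?thesis
      by (simp add: d_def case_prod_unfold algebra_simps)
  qed
  have "d (r1, r2) = 0" for r1 r2
  proof (rule laurent_series_zero_on_circle[OF r])
    fix w2 :: complex assume w2: "norm w2 = r"
    have S: "(\<lambda>r2. d (r1, r2) * w2 powi r2) summable_on UNIV" for r1
    proof -
      have w: "norm (of_real r :: complex) = r" using r by simp
      have "(\<lambda>r2. d (r1, r2) * of_real r powi r1 * w2 powi r2) summable_on UNIV"
        using summable_on_SigmaD1[OF has_sum_imp_summable[OF zero[OF w w2]]] by simp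
      then have "(\<lambda>r2. of_real r powi r1 * (d (r1, r2) * w2 powi r2)) summable_on UNIV"
        by (simp add: mult_ac)
      then show ?thesis using r by (subst (asm) summable_on_cmult_right') simp_all
    qed
    have "(\<Sum>\<^sub>\<infinity>r2. d (r1, r2) * w2 powi r2) = 0"
    proof (rule laurent_series_zero_on_circle[OF r])
      fix w1 :: complex assume w1: "norm w1 = r"
      show "((\<lambda>r1. (\<Sum>\<^sub>\<infinity>r2. d (r1, r2) * w2 powi r2) * w1 powi r1) has_sum 0) UNIV"
      proof (rule has_sum_SigmaD[OF zero[OF w1 w2]])
        fix r1
        have "((\<lambda>r2. (d (r1, r2) * w2 powi r2) * w1 powi r1) has_sum (\<Sum>\<^sub>\<infinity>r2. d (r1, r2) * w2 powi r2) * w1 powi r1) UNIV"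
          by (intro has_sum_cmult_left has_sum_infsum S)
        then show "((\<lambda>y. case (r1, y) of (r1, r2) \<Rightarrow> d (r1, r2) * w1 powi r1 * w2 powi r2) has_sum
            (\<Sum>\<^sub>\<infinity>r2. d (r1, r2) * w2 powi r2) * w1 powi r1) UNIV"
          by (simp add: mult_ac)
      qed
    qed
    then show "((\<lambda>r2. d (r1, r2) * w2 powi r2) has_sum 0) UNIV"
      using has_sum_infsum[OF S, of r1] by simp
  qed
  then show ?thesis by (auto simp: d_def fun_eq_iff)
qed

section \<open>The Laurent expansion of the Schur index\<close>

lemma qpow_conv_exp: "qpow \<tau> x = exp (of_real x * (2 * of_real pi * \<i> * \<tau>))"
  by (simp add: qpow_def mult_ac)

lemma dedekind_eta_conv_euler:
  "dedekind_eta s = exp (2 * of_real pi * \<i> * s / 24) * euler_phi (exp (2 * of_real pi * \<i> * s))"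
  by (simp add: dedekind_eta_def qpow_conv_exp euler_phi_def)

lemma bij_betw_half_ints: "bij_betw (\<lambda>m::int. real_of_int m + 1 / 2) UNIV half_ints"
  by (auto simp: bij_betw_def inj_on_def half_ints_def)

text \<open>For n = j - 1/2 one has e^(pi i n) = -i (-1)^j and n^2/2 = j(j-1)/2 + 1/8, which is the
  origin of the prefactor. The half-integers are enumerated as \<open>j + 1 / 2\<close>, hence the
  shifted index \<open>j + 1\<close> in the computation.\<close>

lemma jacobi_theta_conv_theta:
  fixes z s :: complex
  defines "t \<equiv> 2 * of_real pi * \<i> * s" and "a \<equiv> 2 * of_real pi * \<i> * z"
  shows "jacobi_theta z s = - \<i> * exp (t / 8 - a / 2) * theta t a"
proof -
  let ?f = "\<lambda>n::real. exp (of_real pi * \<i> * of_real n) * qpow s (n\<^sup>2 / 2) * exp (2 * of_real pi * \<i> * of_real n * z)"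
  have summand: "?f (real_of_int j + 1 / 2) = - \<i> * exp (t / 8 - a / 2) * (theta_coeff t (j + 1) * exp (of_int (j + 1) * a))" for j
  proof -
    have "exp (of_real pi * \<i> * of_real (real_of_int j + 1 / 2)) = (exp (\<i> * pi) powi (j + 1)) * exp (- (\<i> * (pi / 2)))"
      unfolding exp_power_int exp_add[symmetric] by (rule arg_cong[of _ _ exp]) (simp add: field_simps)
    also have "exp (- (\<i> * (pi / 2))) = - \<i>"
    proof -
      have "exp (- (\<i> * (pi / 2))) = inverse (cis (pi / 2))"
        by (simp add: cis_conv_exp exp_minus)
      then show ?thesis by simp
    qed
    also have "exp (\<i> * pi) = - 1" by (metis cis_conv_exp cis_pi)
    finally have sg: "exp (of_real pi * \<i> * of_real (real_of_int j + 1 / 2)) = - \<i> * (-1) powi (j + 1)" by simp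
    have qe: "qpow s ((real_of_int j + 1 / 2)\<^sup>2 / 2) * exp (2 * of_real pi * \<i> * of_real (real_of_int j + 1 / 2) * z)
        = exp (t / 8 - a / 2) * (exp (t * (of_int (j + 1) * (of_int (j + 1) - 1) / 2)) * exp (of_int (j + 1) * a))"
      unfolding qpow_conv_exp exp_add[symmetric] t_def a_def
      by (rule arg_cong[of _ _ exp]) (simp add: field_simps power2_eq_square)
    have "?f (real_of_int j + 1 / 2) = (- \<i> * (-1) powi (j + 1))
        * (exp (t / 8 - a / 2) * (exp (t * (of_int (j + 1) * (of_int (j + 1) - 1) / 2)) * exp (of_int (j + 1) * a)))"
      by (rule trans[OF mult.assoc]) (rule arg_cong2[of _ _ _ _ times, OF sg qe])
    then show ?thesis
      unfolding theta_coeff_def by (simp only: mult_ac)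
  qed
  have "jacobi_theta z s = (\<Sum>\<^sub>\<infinity>j. ?f (real_of_int j + 1 / 2))"
    unfolding jacobi_theta_def by (rule infsum_reindex_bij_betw[OF bij_betw_half_ints, symmetric])
  also have "\<dots> = - \<i> * exp (t / 8 - a / 2) * (\<Sum>\<^sub>\<infinity>j. theta_coeff t (j + 1) * exp (of_int (j + 1) * a))"
    unfolding summand by (rule infsum_cmult_right')
  also have "(\<Sum>\<^sub>\<infinity>j. theta_coeff t (j + 1) * exp (of_int (j + 1) * a)) = theta t a"
    unfolding theta_def by (rule infsum_reindex_bij_witness[of _ "\<lambda>j. j - 1" "\<lambda>j. j + 1"]) auto
  finally show ?thesis .
qed

text \<open>Here \<open>2 * p\<close> belongs to the nome Q. Duplication writes \<open>Y\<close> and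
  \<open>Z\<close> as \<open>B * B'\<close> and \<open>C * C'\<close> up to Euler products, and
  \<open>B\<close>, \<open>C\<close> cancel. Since \<open>(p + b) + (p - c) = 2 * p - a\<close>,
  reflection identifies \<open>A\<close> with the numerator in Kronecker's identity for
  \<open>B'\<close> and \<open>C'\<close>.\<close>

lemma theta_quotient_identity:
  fixes p a b c t :: complex
  assumes t: "Re t < Re a" "Re a < 0" and p: "Re p \<le> Re t"
    and b: "Re p < Re b" "Re b < 0" and c: "Re p < Re c" "Re c < 0" and abc: "c = a + b"
  shows "euler_phi (exp t) ^ 3 * euler_phi (exp p) ^ 2 / euler_phi (exp (2 * p))
      * (theta (2 * p) a * theta (2 * p) b * theta (2 * p) c / (theta t a * theta p b * theta p c))
    = infsum (reciprocal_theta_term t a) UNIV * infsum (kronecker_term (2 * p) (p + b) (p - c)) UNIV"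
proof -
  define R K where "R = infsum (reciprocal_theta_term t a) UNIV"
    and "K = infsum (kronecker_term (2 * p) (p + b) (p - c)) UNIV"
  have p0: "Re p < 0" and t0: "Re t < 0" using b t by simp_all
  define F G H where "F = euler_phi (exp t)" and "G = euler_phi (exp p)" and "H = euler_phi (exp (2 * p))"
  have nz: "F \<noteq> 0" "G \<noteq> 0" "H \<noteq> 0"
    using p0 t0 by (auto simp: F_def G_def H_def intro!: euler_phi_nz)
  define X Y Z where "X = theta t a" and "Y = theta p b" and "Z = theta p c"
  define A B C where "A = theta (2 * p) a" and "B = theta (2 * p) b" and "C = theta (2 * p) c"
  define B' C' where "B' = theta (2 * p) (p + b)" and "C' = theta (2 * p) (p - c)"
  have XYZ: "X \<noteq> 0" "Y \<noteq> 0" "Z \<noteq> 0"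
    unfolding X_def Y_def Z_def by (rule theta_nonzero[OF t] theta_nonzero[OF b] theta_nonzero[OF c])+
  have RX: "R * X = F ^ 3"
    unfolding R_def X_def F_def by (rule reciprocal_theta_identity[OF t])
  have "C' = theta (2 * p) (p + c)"
    using theta_reflect[of "2 * p" "p + c"] by (simp add: C'_def)
  then have Y: "Y * H ^ 2 = B * B' * G" and Z: "Z * H ^ 2 = C * C' * G"
    using theta_duplication[OF p0, of b] theta_duplication[OF p0, of c]
    by (simp_all add: Y_def Z_def B_def C_def B'_def G_def H_def add.commute)
  have "theta (2 * p) (p + b + (p - c)) = A"
    using theta_reflect[of "2 * p" a] by (simp add: A_def abc)
  then have KA: "K * (B' * C') = H ^ 3 * A"
    unfolding K_def B'_def C'_def H_def using p0 b c by (subst kronecker_identity) auto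
  have nz': "B \<noteq> 0" "B' \<noteq> 0" "C \<noteq> 0" "C' \<noteq> 0"
    using Y Z XYZ nz by auto
  have R: "R = F ^ 3 / X" and K: "K = H ^ 3 * A / (B' * C')" using RX KA XYZ nz' by (simp_all add: field_simps)
  have Ye: "Y = B * B' * G / H ^ 2" and Ze: "Z = C * C' * G / H ^ 2" using Y Z nz by (simp_all add: field_simps)
  have "F ^ 3 * G ^ 2 / H * (A * B * C / (X * Y * Z)) = R * K"
    unfolding R K Ye Ze using nz nz' XYZ by (simp add: field_simps power2_eq_square power3_eq_cube)
  then show ?thesis
    unfolding R_def K_def F_def G_def H_def X_def Y_def Z_def A_def B_def C_def .
qed

lemma zeta_range_iff:
  fixes \<tau> z1 z2 :: complex
  defines "t \<equiv> 2 * of_real pi * \<i> * \<tau>" and "a \<equiv> 2 * of_real pi * \<i> * z1" and "b \<equiv> 2 * of_real pi * \<i> * z2"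
  shows "(zeta_var z1, zeta_var z2) \<in> zeta_range \<tau> \<longleftrightarrow>
    Re t < Re a \<and> Re a < 0 \<and> Re t < Re b \<and> Re b < 0 \<and> Re t < Re (a + b) \<and> Re (a + b) < 0"
proof -
  have q: "qpow \<tau> 1 = exp t" by (simp add: qpow_conv_exp t_def)
  have z: "zeta_var z1 = exp a" "zeta_var z2 = exp b" by (simp_all add: zeta_var_def a_def b_def)
  have "norm (exp a * exp b) = exp (Re (a + b))" by (simp add: exp_add norm_mult norm_exp_eq_Re)
  then show ?thesis
    unfolding zeta_range_def q z mem_Collect_eq prod.case norm_exp_eq_Re by simp
qed

text \<open>The factor (k+1)/2 is at least 1. Hence the annulus of the nome q contains no point
  outside that of q^((k+1)/2), where the thetas in zeta_2 and zeta_1 zeta_2 live.\<close>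

lemma Re_half_multiple_le:
  assumes "k \<ge> 1" and "Re t < 0"
  shows "Re (of_nat (k + 1) / 2 * t) \<le> Re t"
proof -
  have "(of_nat (k + 1) / 2 :: complex) = of_real (real (k + 1) / 2)" by simp
  then have "Re (of_nat (k + 1) / 2 * t) = real (k + 1) / 2 * Re t"
    by (simp only: Re_complex_of_real Im_complex_of_real times_complex.sel mult_zero_left diff_zero)
  also have "\<dots> \<le> 1 * Re t"
    using assms by (intro mult_right_mono_neg) auto
  finally show ?thesis by simp
qed

text \<open>The eta quotient contributes \<open>exp (t / 8)\<close> and the theta prefactors
  \<open>exp (p / 2 - t / 8)\<close>; the parts depending on \<open>a\<close> and \<open>b\<close>
  cancel, as numerator and denominator have the same elliptic arguments. What remains,
  \<open>exp (p / 2)\<close>, is q^((k+1)/4).\<close>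

lemma eta_schur_eq:
  fixes k :: nat and \<tau> z1 z2 :: complex
  defines "t \<equiv> 2 * of_real pi * \<i> * \<tau>" and "a \<equiv> 2 * of_real pi * \<i> * z1" and "b \<equiv> 2 * of_real pi * \<i> * z2"
  defines "p \<equiv> of_nat (k + 1) / 2 * t"
  assumes k: "k \<ge> 1" and z: "(zeta_var z1, zeta_var z2) \<in> zeta_range \<tau>"
  shows "eta_factor k \<tau> * schur_T k \<tau> z1 z2
    = exp (p / 2) * (infsum (reciprocal_theta_term t a) UNIV
        * infsum (kronecker_term (2 * p) (p + b) (p - (a + b))) UNIV)"
proof -
  have r: "Re t < Re a" "Re a < 0" "Re t < Re b" "Re b < 0" "Re t < Re (a + b)" "Re (a + b) < 0"
    using z unfolding zeta_range_iff t_def a_def b_def by blast+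
  have t0: "Re t < 0" using r by linarith
  have pt: "Re p \<le> Re t" unfolding p_def by (rule Re_half_multiple_le[OF k t0])
  have args: "2 * of_real pi * \<i> * (of_nat (k + 1) * \<tau>) = 2 * p"
    "2 * of_real pi * \<i> * (of_nat (k + 1) / 2 * \<tau>) = p" "2 * of_real pi * \<i> * \<tau> = t"
    "2 * of_real pi * \<i> * z1 = a" "2 * of_real pi * \<i> * z2 = b" "2 * of_real pi * \<i> * (z1 + z2) = a + b"
    by (simp_all add: p_def t_def a_def b_def field_simps)
  define F G H where "F = euler_phi (exp t)" and "G = euler_phi (exp p)" and "H = euler_phi (exp (2 * p))"
  define X Y Z where "X = theta t a" and "Y = theta p b" and "Z = theta p (a + b)"
  define A B C where "A = theta (2 * p) a" and "B = theta (2 * p) b" and "C = theta (2 * p) (a + b)"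
  have nz: "X \<noteq> 0" "Y \<noteq> 0" "Z \<noteq> 0"
    unfolding X_def Y_def Z_def using r pt by (simp_all add: theta_nonzero)
  have Hnz: "H \<noteq> 0" unfolding H_def using pt t0 by (intro euler_phi_nz) simp
  have "eta_factor k \<tau> = (exp (t / 24) * F) ^ 3 * (exp (p / 24) * G) ^ 2 / (exp (2 * p / 24) * H)"
    unfolding eta_factor_def dedekind_eta_conv_euler args F_def G_def H_def ..
  also have "\<dots> = (exp (t / 24) ^ 3 * exp (p / 24) ^ 2 / exp (2 * p / 24)) * (F ^ 3 * G ^ 2 / H)"
    using Hnz by (simp add: power_mult_distrib)
  also have "exp (t / 24) ^ 3 * exp (p / 24) ^ 2 / exp (2 * p / 24) = exp (t / 8)"
    by (simp add: exp_of_nat_mult[symmetric] exp_add[symmetric] exp_diff[symmetric])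
  finally have eta: "eta_factor k \<tau> = exp (t / 8) * (F ^ 3 * G ^ 2 / H)" .
  have "schur_T k \<tau> z1 z2 = ((- \<i> * exp (2 * p / 8 - a / 2) * A) * (- \<i> * exp (2 * p / 8 - b / 2) * B)
      * (- \<i> * exp (2 * p / 8 - (a + b) / 2) * C))
      / ((- \<i> * exp (t / 8 - a / 2) * X) * (- \<i> * exp (p / 8 - b / 2) * Y) * (- \<i> * exp (p / 8 - (a + b) / 2) * Z))"
    unfolding schur_T_def jacobi_theta_conv_theta args A_def B_def C_def X_def Y_def Z_def ..
  also have "\<dots> = (exp (2 * p / 8 - a / 2) * exp (2 * p / 8 - b / 2) * exp (2 * p / 8 - (a + b) / 2))
      / (exp (t / 8 - a / 2) * exp (p / 8 - b / 2) * exp (p / 8 - (a + b) / 2)) * (A * B * C / (X * Y * Z))"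
    by (simp add: mult_ac)
  also have "(exp (2 * p / 8 - a / 2) * exp (2 * p / 8 - b / 2) * exp (2 * p / 8 - (a + b) / 2))
      / (exp (t / 8 - a / 2) * exp (p / 8 - b / 2) * exp (p / 8 - (a + b) / 2)) = exp (p / 2 - t / 8)"
    unfolding exp_add[symmetric] exp_diff[symmetric] by (rule arg_cong[of _ _ exp]) (simp add: field_simps)
  finally have T: "schur_T k \<tau> z1 z2 = exp (p / 2 - t / 8) * (A * B * C / (X * Y * Z))" .
  have "eta_factor k \<tau> * schur_T k \<tau> z1 z2
      = (exp (t / 8) * exp (p / 2 - t / 8)) * ((F ^ 3 * G ^ 2 / H) * (A * B * C / (X * Y * Z)))"
    unfolding eta T by (simp only: mult_ac)
  also have "exp (t / 8) * exp (p / 2 - t / 8) = exp (p / 2)"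
    unfolding exp_add[symmetric] by simp
  also have "(F ^ 3 * G ^ 2 / H) * (A * B * C / (X * Y * Z)) = infsum (reciprocal_theta_term t a) UNIV
        * infsum (kronecker_term (2 * p) (p + b) (p - (a + b))) UNIV"
    unfolding F_def G_def H_def A_def B_def C_def X_def Y_def Z_def
    by (rule theta_quotient_identity) (use r pt in auto)
  finally show ?thesis .
qed

text \<open>With indices \<open>(n1, m)\<close> for the reciprocal and \<open>(m', n2)\<close> for
  Kronecker's series, zeta_1 and zeta_2 have the exponents \<open>m - n2\<close> and
  \<open>m' - n2\<close>. Hence \<open>m = n2 + r1\<close> and \<open>m' = n2 + r2\<close>, the
  shifts seen in \<open>coeff_term\<close>. The prefactor for \<open>r2\<close> collects
  \<open>exp (p / 2)\<close> and \<open>exp (p * r2)\<close>.\<close>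

lemma eta_schur_has_sum:
  fixes k :: nat and \<tau> z1 z2 :: complex
  assumes k: "k \<ge> 1" and z: "(zeta_var z1, zeta_var z2) \<in> zeta_range \<tau>"
  shows "((\<lambda>((r1, r2), n). qpow \<tau> (real (k + 1) / 4 * (2 * of_int r2 + 1)) * coeff_term k \<tau> r1 r2 n
      * zeta_var z1 powi r1 * zeta_var z2 powi r2) has_sum eta_factor k \<tau> * schur_T k \<tau> z1 z2) UNIV"
proof -
  define t a b where "t = 2 * of_real pi * \<i> * \<tau>" and "a = 2 * of_real pi * \<i> * z1" and "b = 2 * of_real pi * \<i> * z2"
  define p where "p = of_nat (k + 1) / 2 * t"
  have r: "Re t < Re a" "Re a < 0" "Re t < Re b" "Re b < 0" "Re t < Re (a + b)" "Re (a + b) < 0"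
    using z unfolding zeta_range_iff t_def a_def b_def by blast+
  have t0: "Re t < 0" using r by linarith
  have pt: "Re p \<le> Re t" unfolding p_def by (rule Re_half_multiple_le[OF k t0])
  let ?R = "reciprocal_theta_term t a" and ?K = "kronecker_term (2 * p) (p + b) (p - (a + b))"
  let ?V = "infsum ?R UNIV * infsum ?K UNIV"
  have "((\<lambda>(x, y). ?R x * ?K y) has_sum ?V) (UNIV \<times> UNIV)"
    by (intro has_sum_times_complex has_sum_infsum summable_reciprocal_theta_term summable_kronecker_term)
       (use r pt in auto)
  then have "((\<lambda>z. exp (p / 2) * (case z of (x, y) \<Rightarrow> ?R x * ?K y)) has_sum exp (p / 2) * ?V) (UNIV \<times> UNIV)"
    by (rule has_sum_cmult_right)
  also have "exp (p / 2) * ?V = eta_factor k \<tau> * schur_T k \<tau> z1 z2"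
    using eta_schur_eq[OF k z] by (simp add: t_def a_def b_def p_def)
  also have "((\<lambda>z. exp (p / 2) * (case z of (x, y) \<Rightarrow> ?R x * ?K y)) has_sum eta_factor k \<tau> * schur_T k \<tau> z1 z2) (UNIV \<times> UNIV)
    \<longleftrightarrow> ?thesis"
  proof (rule has_sum_reindex_bij_witness[of _ "\<lambda>((r1, r2), (n1, n2)). ((n1, n2 + r1), (n2 + r2, n2))"
        "\<lambda>((n1, m), (m', n2)). ((m - n2, m' - n2), (n1, n2))"])
    fix x :: "(int \<times> int) \<times> int \<times> int"
    obtain n1 m m' n2 where x: "x = ((n1, m), (m', n2))" by (metis prod.exhaust)
    define r1 r2 where "r1 = m - n2" and "r2 = m' - n2"
    have m: "m = n2 + r1" "m' = n2 + r2" by (simp_all add: r1_def r2_def)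
    have zp: "zeta_var z1 powi r1 = exp (of_int r1 * a)" "zeta_var z2 powi r2 = exp (of_int r2 * b)"
      by (simp_all add: zeta_var_def a_def b_def exp_power_int)
    have "exp (p / 2) * (exp (t * (of_int (- n1) * (of_int (- n1) - 1) / 2))
          * exp (t * (of_int n1 * of_int m) + a * of_int m)
          * exp (2 * p * (of_int m' * of_int n2) + (p + b) * of_int m' + (p - (a + b)) * of_int n2))
        = qpow \<tau> (real (k + 1) / 4 * (2 * of_int r2 + 1))
          * qpow \<tau> (of_int n1 * (of_int n1 + 1) / 2 + of_int n1 * (of_int n2 + of_int r1)
              + real (k + 1) * (of_int n2)\<^sup>2 + real (k + 1) * (of_int r2 + 1) * of_int n2)
          * exp (of_int r1 * a) * exp (of_int r2 * b)"
      unfolding qpow_conv_exp t_def[symmetric] exp_add[symmetric] m p_def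
      by (rule arg_cong[of _ _ exp]) (simp add: field_simps power2_eq_square)
    moreover have "(-1) powi (- n1) = ((-1) powi n1 :: complex)"
      by (rule power_int_minus_one_minus)
    ultimately show "(\<lambda>((r1, r2), n). qpow \<tau> (real (k + 1) / 4 * (2 * of_int r2 + 1)) * coeff_term k \<tau> r1 r2 n
        * zeta_var z1 powi r1 * zeta_var z2 powi r2) ((\<lambda>((n1, m), (m', n2)). ((m - n2, m' - n2), (n1, n2))) x)
      = exp (p / 2) * (case x of (x, y) \<Rightarrow> ?R x * ?K y)"
      unfolding x prod.case r1_def[symmetric] r2_def[symmetric] zp coeff_term_def reciprocal_theta_term_def
        kronecker_term_def theta_coeff_def m[symmetric]
      by (simp add: mult_ac m)
  qed auto
  finally show ?thesis .
qed

section \<open>The constant term and the series \<open>F_fun\<close>\<close>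

lemma summable_exp_gauss_int:
  fixes c d :: real
  assumes "c > 0"
  shows "(\<lambda>j::int. exp (d * of_int j - c * (of_int j)\<^sup>2)) summable_on UNIV"
  by (rule summable_on_comparison_test[OF summable_linear_gauss_int[OF assms, of d]])
     (simp_all add: mult_le_cancel_right1)

definition F_term_unsigned :: "nat \<Rightarrow> complex \<Rightarrow> int \<times> int \<Rightarrow> complex" where
  "F_term_unsigned k \<tau> = (\<lambda>(n1, n2). (-1) powi n1 * qpow \<tau> ((of_int n1)\<^sup>2 / 2 + of_int n1 * (of_int n2 + 1 / 2)
     + real (k + 1) * (of_int n2 + 1 / 2)\<^sup>2))"

text \<open>The quadratic form is positive definite: with y half-integral, x^2/2 + x y + 2 y^2 =
  (x/2 + y)^2 + x^2/4 + y^2. The series thus converges even without its signs and may be split into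
  pieces.\<close>

lemma summable_F_term_unsigned:
  assumes k: "k \<ge> 1" and \<tau>: "Im \<tau> > 0"
  shows "(\<lambda>p. norm (F_term_unsigned k \<tau> p)) summable_on UNIV"
proof -
  define c where "c = 2 * pi * Im \<tau>"
  have c: "c > 0" using \<tau> by (simp add: c_def)
  have Req: "norm (qpow \<tau> x) = exp (- c * x)" for x
    by (simp add: qpow_conv_exp norm_exp_eq_Re c_def)
  let ?f = "\<lambda>m::int. exp (0 * of_int m - (c / 4) * (of_int m)\<^sup>2)"
    and ?g = "\<lambda>n::int. exp (- c * of_int n - c * (of_int n)\<^sup>2)"
  have f: "?f summable_on UNIV" and g: "?g summable_on UNIV"
    using c summable_exp_gauss_int[of "c / 4" 0] summable_exp_gauss_int[of c "- c"] by simp_all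
  have prod: "(\<lambda>(m, n). ?f m * ?g n) summable_on UNIV \<times> UNIV"
  proof (rule summable_on_SigmaI)
    show "((\<lambda>n. case (m, n) of (m, n) \<Rightarrow> ?f m * ?g n) has_sum ?f m * infsum ?g UNIV) UNIV" for m
      unfolding prod.case by (intro has_sum_cmult_right has_sum_infsum g)
    show "(\<lambda>m. ?f m * infsum ?g UNIV) summable_on UNIV"
      by (intro summable_on_cmult_left f)
  qed auto
  show ?thesis
  proof (rule summable_on_comparison_test)
    show "(\<lambda>(m, n). ?f m * ?g n) summable_on UNIV" using prod by simp
    fix p :: "int \<times> int"
    obtain m n where p: "p = (m, n)" by (cases p)
    define x y where "x = real_of_int m" and "y = real_of_int n"
    have "0 \<le> (x / 2 + (y + 1 / 2))\<^sup>2" by simp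
    moreover have "2 * (y + 1 / 2)\<^sup>2 \<le> real (k + 1) * (y + 1 / 2)\<^sup>2"
      using k by (intro mult_right_mono) auto
    ultimately have "x\<^sup>2 / 4 + (y\<^sup>2 + y) \<le> x\<^sup>2 / 2 + x * (y + 1 / 2) + real (k + 1) * (y + 1 / 2)\<^sup>2"
      by (simp add: power2_eq_square field_simps)
    then have "- c * (x\<^sup>2 / 2 + x * (y + 1 / 2) + real (k + 1) * (y + 1 / 2)\<^sup>2) \<le> - c * (x\<^sup>2 / 4 + (y\<^sup>2 + y))"
      using c by simp
    also have "\<dots> = (0 * x - c / 4 * x\<^sup>2) + (- c * y - c * y\<^sup>2)" by (simp add: algebra_simps)
    finally show "norm (F_term_unsigned k \<tau> p) \<le> (case p of (m, n) \<Rightarrow> ?f m * ?g n)"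
      unfolding p prod.case F_term_unsigned_def norm_mult Req exp_add[symmetric] x_def y_def
      by (simp add: norm_power_int)
  qed auto
qed

lemma infsum_anti_invariant:
  fixes f :: "'a \<Rightarrow> complex"
  assumes "\<And>x. i (i x) = x" and "\<And>x. f (i x) = - f x"
  shows "infsum f UNIV = 0"
proof -
  have "infsum f UNIV = infsum (\<lambda>x. - f x) UNIV"
    by (rule infsum_reindex_bij_witness[of _ i i]) (use assms in auto)
  then show ?thesis by (simp add: infsum_uminus)
qed

lemma half_ints_reindex:
  "bij_betw (\<lambda>(n1, n2). (n1, real_of_int n2 + 1 / 2)) UNIV (UNIV \<times> half_ints)"
  by (auto simp: bij_betw_def inj_on_def half_ints_def)

lemma sgn_half_int: "sgn (real_of_int n + 1 / 2) = (if 0 \<le> n then 1 else - 1)"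
  using rho_eq[of n n] by (auto simp: rho_def)

lemma F_term_half_int:
  "F_term k \<tau> (n1, real_of_int n2 + 1 / 2)
    = of_int (sgn n1) * of_real (sgn (of_int n2 + 1 / 2)) * F_term_unsigned k \<tau> (n1, n2)"
  by (simp add: F_term_def F_term_unsigned_def mult_ac)

lemma F_term_summable_on:
  assumes "k \<ge> 1" "Im \<tau> > 0"
  shows "F_term k \<tau> summable_on (UNIV \<times> half_ints)"
proof -
  have "(\<lambda>p. norm (F_term k \<tau> (case p of (n1, n2) \<Rightarrow> (n1, real_of_int n2 + 1 / 2)))) summable_on UNIV"
  proof (rule Infinite_Sum.abs_summable_on_comparison_test'[OF summable_F_term_unsigned[OF assms]])
    fix p :: "int \<times> int"
    have "norm (complex_of_int (sgn n1) * of_real (sgn (real_of_int n2 + 1 / 2))) \<le> 1" for n1 n2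
      unfolding sgn_half_int by (auto simp: norm_mult sgn_if)
    then show "norm (F_term k \<tau> (case p of (n1, n2) \<Rightarrow> (n1, real_of_int n2 + 1 / 2))) \<le> norm (F_term_unsigned k \<tau> p)"
      by (cases p) (simp only: prod.case F_term_half_int norm_mult[of "_ * _"] mult_left_le_one_le norm_ge_zero)
  qed
  then have "(\<lambda>p. F_term k \<tau> (case p of (n1, n2) \<Rightarrow> (n1, real_of_int n2 + 1 / 2))) summable_on UNIV"
    by (rule abs_summable_summable)
  then show ?thesis
    using summable_on_reindex_bij_betw[OF half_ints_reindex, of "F_term k \<tau>"] by simp
qed

text \<open>Up to a factor 2, the two sums differ by the unsigned sum and by its part with \<open>n1 = 0\<close>. The
  quadratic form is invariant under \<open>n1 \<mapsto> - n1 - 2 n2 - 1\<close> and, for \<open>n1 = 0\<close>, under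
  \<open>n2 \<mapsto> - 1 - n2\<close>, while the signs flip, so both contributions vanish.\<close>

lemma F_fun_eq_coeff_sum:
  assumes k: "k \<ge> 1" and \<tau>: "Im \<tau> > 0" and S: "coeff_term k \<tau> 0 0 summable_on UNIV"
  shows "F_fun k \<tau> = qpow \<tau> (real (k + 1) / 4) * (\<Sum>\<^sub>\<infinity>n. coeff_term k \<tau> 0 0 n)"
proof -
  let ?B = "F_term_unsigned k \<tau>"
  define s :: "int \<Rightarrow> complex" where "s n = of_real (sgn (real_of_int n + 1 / 2))" for n
  define G where "G = (\<lambda>(n1, n2). F_term k \<tau> (n1, real_of_int n2 + 1 / 2))"
  define Z where "Z = (\<lambda>(n1, n2). if n1 = 0 then s n2 * ?B (n1, n2) else 0)"
  have sB: "?B summable_on UNIV"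
    using summable_F_term_unsigned[OF k \<tau>] by (rule abs_summable_summable)
  have sZ: "Z summable_on UNIV"
  proof (rule abs_summable_summable, rule Infinite_Sum.abs_summable_on_comparison_test'[OF summable_F_term_unsigned[OF k \<tau>]])
    show "norm (Z p) \<le> norm (?B p)" for p
      by (cases p) (simp add: Z_def s_def sgn_half_int norm_mult)
  qed
  have sG: "G summable_on UNIV" and G: "infsum G UNIV = (\<Sum>\<^sub>\<infinity>n\<in>UNIV \<times> half_ints. F_term k \<tau> n)"
    using summable_on_reindex_bij_betw[OF half_ints_reindex, of "F_term k \<tau>"]
      infsum_reindex_bij_betw[OF half_ints_reindex, of "F_term k \<tau>"] F_term_summable_on[OF k \<tau>]
    by (simp_all add: G_def case_prod_unfold)
  have "infsum ?B UNIV = 0"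
  proof (rule infsum_anti_invariant[of "\<lambda>(n1, n2). (- n1 - 2 * n2 - 1, n2)"])
    fix p :: "int \<times> int"
    obtain m n where p: "p = (m, n)" by (cases p)
    have "(-1) powi (- m - 2 * n - 1) = - ((-1) powi m :: complex)"
      by (simp add: power_int_minus_left)
    moreover have "(of_int (- m - 2 * n - 1))\<^sup>2 / 2 + of_int (- m - 2 * n - 1) * (of_int n + 1 / 2)
        = (of_int m)\<^sup>2 / 2 + of_int m * (of_int n + 1 / 2 :: real)"
      by (simp add: power2_eq_square field_simps)
    ultimately show "?B (case p of (n1, n2) \<Rightarrow> (- n1 - 2 * n2 - 1, n2)) = - ?B p"
      unfolding p prod.case F_term_unsigned_def by (simp only:) simp
  qed auto
  moreover have "infsum Z UNIV = 0"
  proof (rule infsum_anti_invariant[of "\<lambda>(n1, n2). (n1, - 1 - n2)"])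
    fix p :: "int \<times> int"
    obtain m n where p: "p = (m, n)" by (cases p)
    have "s (- 1 - n) = - s n" unfolding s_def sgn_half_int by simp
    moreover have "?B (0, - 1 - n) = ?B (0, n)"
      unfolding F_term_unsigned_def by (simp add: power2_eq_square algebra_simps)
    ultimately show "Z (case p of (n1, n2) \<Rightarrow> (n1, - 1 - n2)) = - Z p"
      by (simp add: p Z_def)
  qed auto
  moreover have "2 * (qpow \<tau> (real (k + 1) / 4) * coeff_term k \<tau> 0 0 p) = G p + (Z p + ?B p)" for p
  proof -
    obtain m n where p: "p = (m, n)" by (cases p)
    have "qpow \<tau> (real (k + 1) / 4) * qpow \<tau> (of_int m * (of_int m + 1) / 2 + of_int m * (of_int n + of_int 0)
           + real (k + 1) * (of_int n)\<^sup>2 + real (k + 1) * (of_int 0 + 1) * of_int n)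
        = qpow \<tau> ((of_int m)\<^sup>2 / 2 + of_int m * (of_int n + 1 / 2) + real (k + 1) * (of_int n + 1 / 2)\<^sup>2)"
      unfolding qpow_conv_exp exp_add[symmetric]
      by (rule arg_cong[of _ _ exp]) (simp add: power2_eq_square field_simps)
    then have "qpow \<tau> (real (k + 1) / 4) * coeff_term k \<tau> 0 0 p
        = of_real (rho m n) * of_real (rho n n) * ?B (m, n)"
      unfolding p coeff_term_def prod.case F_term_unsigned_def by (simp add: mult_ac)
    \<comment> \<open>Here \<open>rho n n = s n\<close>, \<open>s n * s n = 1\<close>, and the sign
      of \<open>m + 1 / 2\<close> is \<open>sgn m\<close> except at \<open>m = 0\<close>, where it
      is 1; this exception produces \<open>Z\<close>.\<close>
    moreover have "2 * (of_real (rho m n) * of_real (rho n n)) = of_int (sgn m) * s n + (if m = 0 then s n else 0) + (1 :: complex)"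
      unfolding rho_eq s_def sgn_half_int by auto
    ultimately have "2 * (qpow \<tau> (real (k + 1) / 4) * coeff_term k \<tau> 0 0 p)
        = (of_int (sgn m) * s n + (if m = 0 then s n else 0) + 1) * ?B (m, n)"
      by (simp only: mult.assoc[symmetric])
    then show ?thesis
      by (simp add: p G_def Z_def F_term_half_int s_def distrib_right)
  qed
  then have "(\<Sum>\<^sub>\<infinity>p. 2 * (qpow \<tau> (real (k + 1) / 4) * coeff_term k \<tau> 0 0 p)) = infsum G UNIV + (infsum Z UNIV + infsum ?B UNIV)"
    using sG sZ sB by (simp add: infsum_add summable_on_add)
  ultimately have "infsum G UNIV = 2 * (qpow \<tau> (real (k + 1) / 4) * (\<Sum>\<^sub>\<infinity>n. coeff_term k \<tau> 0 0 n))"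
    by (simp only: infsum_cmult_right') simp
  then show ?thesis
    unfolding F_fun_def G[symmetric] by (simp only:) simp
qed

text \<open>The radius is |q|^(1/4), so that the product of the variables has modulus |q|^(1/2) and
  also lies strictly between |q| and 1.\<close>

lemma zeta_range_torus:
  assumes "Im \<tau> > 0" "norm w1 = exp (- pi * Im \<tau> / 2)" "norm w2 = exp (- pi * Im \<tau> / 2)"
  shows "(w1, w2) \<in> zeta_range \<tau>"
  using assms by (simp add: zeta_range_def qpow_conv_exp norm_exp_eq_Re norm_mult exp_add[symmetric])

text \<open>The clauses on unique existence and summability give the equations their content:
  \<open>laurent_coeff\<close> is a definite description, and \<open>infsum\<close> is 0 on families
  that are not summable.\<close>

theorem proposition7p1:
  fixes k :: nat and \<tau> :: complex
  assumes "k \<ge> 1" and "Im \<tau> > 0"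
  shows "(\<exists>!c. laurent_expansion (schur_T k \<tau>) (zeta_range \<tau>) c)
    \<and> (\<exists>!c. laurent_expansion (\<lambda>z1 z2. eta_factor k \<tau> * schur_T k \<tau> z1 z2) (zeta_range \<tau>) c)
    \<and> (\<forall>r1 r2 :: int.
         coeff_term k \<tau> r1 r2 summable_on UNIV
       \<and> laurent_coeff (\<lambda>z1 z2. eta_factor k \<tau> * schur_T k \<tau> z1 z2) (zeta_range \<tau>) (r1, r2)
         = qpow \<tau> (real (k + 1) / 4 * (2 * of_int r2 + 1))
           * (\<Sum>\<^sub>\<infinity>n\<in>UNIV. coeff_term k \<tau> r1 r2 n))
    \<and> F_term k \<tau> summable_on (UNIV \<times> half_ints)
    \<and> F_fun k \<tau> = eta_factor k \<tau> * constant_term (schur_T k \<tau>) (zeta_range \<tau>)"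
proof -
  note k = assms(1) and \<tau> = assms(2)
  let ?D = "zeta_range \<tau>" and ?g = "\<lambda>z1 z2. eta_factor k \<tau> * schur_T k \<tau> z1 z2"
  have unique: "c = c'" if "laurent_expansion f ?D c" "laurent_expansion f ?D c'" for f c c'
    by (rule laurent_expansion_unique[OF that exp_gt_zero zeta_range_torus[OF \<tau>]])
  have coeff: "laurent_coeff f ?D = c" if "laurent_expansion f ?D c" for f c
    unfolding laurent_coeff_def using that unique by blast
  have eta: "eta_factor k \<tau> \<noteq> 0"
  proof -
    have "dedekind_eta s \<noteq> 0" if "Im s > 0" for s
      using that by (simp add: dedekind_eta_conv_euler euler_phi_nz)
    moreover have "Im (of_nat (k + 1) / 2 * \<tau>) = real (k + 1) / 2 * Im \<tau>"
      using times_complex.sel(2)[of "of_real (real (k + 1) / 2)" \<tau>] by simp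
    moreover have "Im (of_nat (k + 1) * \<tau>) = real (k + 1) * Im \<tau>" by simp
    ultimately show ?thesis
      using \<tau> unfolding eta_factor_def by (simp del: of_nat_Suc of_nat_add)
  qed
  define Q where "Q r2 = qpow \<tau> (real (k + 1) / 4 * (2 * of_int r2 + 1))" for r2 :: int
  have Q: "Q r2 \<noteq> 0" for r2 by (simp add: Q_def qpow_conv_exp)
  have H: "((\<lambda>((r1, r2), n). Q r2 * coeff_term k \<tau> r1 r2 n * zeta_var z1 powi r1 * zeta_var z2 powi r2)
      has_sum ?g z1 z2) (UNIV \<times> UNIV)" if "(zeta_var z1, zeta_var z2) \<in> ?D" for z1 z2
    using eta_schur_has_sum[OF k that] by (simp add: Q_def)
  have zv: "zeta_var z \<noteq> 0" for z by (simp add: zeta_var_def)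
  have sc: "coeff_term k \<tau> r1 r2 summable_on UNIV" for r1 r2
  proof -
    \<comment> \<open>A sample point on the torus of radius |q|^(1/4): there the fourfold family is
      summable, hence so is each fibre, and the nonzero monomial can be removed.\<close>
    have "norm (zeta_var (\<tau> / 4)) = exp (- pi * Im \<tau> / 2)"
      by (simp add: zeta_var_def norm_exp_eq_Re)
    then have D: "(zeta_var (\<tau> / 4), zeta_var (\<tau> / 4)) \<in> ?D" using zeta_range_torus[OF \<tau>] by blast
    define C where "C = Q r2 * zeta_var (\<tau> / 4) powi r1 * zeta_var (\<tau> / 4) powi r2"
    have "C \<noteq> 0" by (simp add: C_def Q zv)
    have "(\<lambda>n. Q r2 * coeff_term k \<tau> r1 r2 n * zeta_var (\<tau> / 4) powi r1 * zeta_var (\<tau> / 4) powi r2) summable_on UNIV"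
      using summable_on_SigmaD1[of "\<lambda>x n. (case x of (r1, r2) \<Rightarrow> \<lambda>n. Q r2 * coeff_term k \<tau> r1 r2 n
          * zeta_var (\<tau> / 4) powi r1 * zeta_var (\<tau> / 4) powi r2) n" UNIV "\<lambda>_. UNIV" "(r1, r2)"]
        has_sum_imp_summable[OF H[OF D]] by (simp add: case_prod_unfold)
    then have "(\<lambda>n. C * coeff_term k \<tau> r1 r2 n) summable_on UNIV"
      by (simp add: C_def mult_ac)
    then show ?thesis using \<open>C \<noteq> 0\<close> by (simp add: summable_on_cmult_right')
  qed
  define c where "c = (\<lambda>(r1, r2). Q r2 * (\<Sum>\<^sub>\<infinity>n. coeff_term k \<tau> r1 r2 n))"
  have c: "laurent_expansion ?g ?D c"
    unfolding laurent_expansion_def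
  proof (intro allI impI)
    fix z1 z2 assume "(zeta_var z1, zeta_var z2) \<in> ?D"
    from H[OF this] show "((\<lambda>(r1, r2). c (r1, r2) * zeta_var z1 powi r1 * zeta_var z2 powi r2) has_sum ?g z1 z2) UNIV"
    proof (rule has_sum_SigmaD)
      fix x :: "int \<times> int"
      obtain r1 r2 where x: "x = (r1, r2)" by (cases x)
      have "((\<lambda>n. Q r2 * coeff_term k \<tau> r1 r2 n * zeta_var z1 powi r1 * zeta_var z2 powi r2)
          has_sum c (r1, r2) * zeta_var z1 powi r1 * zeta_var z2 powi r2) UNIV"
        unfolding c_def prod.case by (intro has_sum_cmult_left has_sum_cmult_right has_sum_infsum sc)
      then show "((\<lambda>n. (\<lambda>((r1, r2), n). Q r2 * coeff_term k \<tau> r1 r2 n * zeta_var z1 powi r1 * zeta_var z2 powi r2) (x, n))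
          has_sum (case x of (r1, r2) \<Rightarrow> c (r1, r2) * zeta_var z1 powi r1 * zeta_var z2 powi r2)) UNIV"
        by (simp add: x)
    qed
  qed
  have c': "laurent_expansion (schur_T k \<tau>) ?D (\<lambda>r. inverse (eta_factor k \<tau>) * c r)"
    unfolding laurent_expansion_def
  proof (intro allI impI)
    fix z1 z2 assume "(zeta_var z1, zeta_var z2) \<in> ?D"
    with c have g: "((\<lambda>(r1, r2). c (r1, r2) * zeta_var z1 powi r1 * zeta_var z2 powi r2) has_sum ?g z1 z2) UNIV"
      unfolding laurent_expansion_def by blast
    have e: "inverse (eta_factor k \<tau>) * ?g z1 z2 = schur_T k \<tau> z1 z2" using eta by simp
    note has_sum_cmult_right[OF g, of "inverse (eta_factor k \<tau>)", unfolded e]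
    then show "((\<lambda>(r1, r2). inverse (eta_factor k \<tau>) * c (r1, r2) * zeta_var z1 powi r1 * zeta_var z2 powi r2)
        has_sum schur_T k \<tau> z1 z2) UNIV"
      by (simp add: case_prod_unfold mult.assoc)
  qed
  have "eta_factor k \<tau> * constant_term (schur_T k \<tau>) ?D = c (0, 0)"
    unfolding constant_term_def coeff[OF c'] using eta by simp
  also have "\<dots> = F_fun k \<tau>"
    using F_fun_eq_coeff_sum[OF k \<tau> sc] by (simp add: c_def Q_def)
  finally have "F_fun k \<tau> = eta_factor k \<tau> * constant_term (schur_T k \<tau>) ?D" by simp
  moreover have "laurent_coeff ?g ?D (r1, r2) = Q r2 * (\<Sum>\<^sub>\<infinity>n. coeff_term k \<tau> r1 r2 n)" for r1 r2
    unfolding coeff[OF c] by (simp add: c_def)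
  ultimately show ?thesis
    using c c' unique sc F_term_summable_on[OF k \<tau>] unfolding Q_def by blast
qed

end
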